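(* Let $R$ be a ring with unity and let $\mathcal{X}$ be a semibrick in the category $R\text{-Mod}$ of left $R$-modules. Then $\mathrm{Filt}(\mathcal{X})$, regarded as a full subcategory, is a wide subcategory of $R\text{-Mod}$.
   Context: A brick is a finitely presented left $R$-module whose endomorphism ring is a division ring. Two non-isomorphic bricks $X,Y$ are orthogonal if $\mathrm{Hom}(X,Y)=\mathrm{Hom}(Y,X)=0$. A semibrick is a class $\mathcal{X}$ of pairwise orthogonal (in particular pairwise non-isomorphic) bricks. For an ordinal $\mu$, a filtration of a module $M$ is an ascending chain $(M_\lambda,\lambda\le\mu)$ of submodules with $M_0=0$, $M_\mu=M$ and $M_\nu=\bigcup_{\lambda<\nu}M_\lambda$ for every limit ordinal $\nu\le\mu$. It is an $\mathcal{X}$-filtration if each factor $M_{\lambda+1}/M_\lambda$ ($\lambda<\mu$) is isomorphic to a module in $\mathcal{X}$. $\mathrm{Filt}(\mathcal{X})$ is the class of all modules admitting an $\mathcal{X}$-filtration (of arbitrary ordinal length). A full subcategory $\mathcal{C}$ of an abelian category $\mathcal{A}$ is called wide if it is abelian (as a subcategory of $\mathcal{A}$, i.e. closed under kernels and cokernels taken in $\mathcal{A}$) and closed under extensions in $\mathcal{A}$. *)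

theory Defs
  imports "HOL-Algebra.Module" "HOL-Algebra.AbelCoset"
begin

text \<open>The library's locale \<open>module\<close> assumes a commutative ring of scalars. Over an arbitrary
  unital ring we keep its record type (whose fields \<open>mult\<close> and \<open>one\<close> are never used)
  and its axioms, and use the locale \<open>submodule\<close>, which does not assume commutativity.\<close>

locale left_module = R?: ring R + M?: abelian_group M
  for R :: "('r, 's) ring_scheme" (structure) and M :: "('r, 'm, 't) module_scheme" (structure) +
  assumes smult_closed [simp, intro]:
      "\<lbrakk>a \<in> carrier R; x \<in> carrier M\<rbrakk> \<Longrightarrow> a \<odot>\<^bsub>M\<^esub> x \<in> carrier M"
    and smult_l_distr:
      "\<lbrakk>a \<in> carrier R; b \<in> carrier R; x \<in> carrier M\<rbrakk>
        \<Longrightarrow> (a \<oplus>\<^bsub>R\<^esub> b) \<odot>\<^bsub>M\<^esub> x = a \<odot>\<^bsub>M\<^esub> x \<oplus>\<^bsub>M\<^esub> b \<odot>\<^bsub>M\<^esub> x"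
    and smult_r_distr:
      "\<lbrakk>a \<in> carrier R; x \<in> carrier M; y \<in> carrier M\<rbrakk>
        \<Longrightarrow> a \<odot>\<^bsub>M\<^esub> (x \<oplus>\<^bsub>M\<^esub> y) = a \<odot>\<^bsub>M\<^esub> x \<oplus>\<^bsub>M\<^esub> a \<odot>\<^bsub>M\<^esub> y"
    and smult_assoc1:
      "\<lbrakk>a \<in> carrier R; b \<in> carrier R; x \<in> carrier M\<rbrakk>
        \<Longrightarrow> (a \<otimes>\<^bsub>R\<^esub> b) \<odot>\<^bsub>M\<^esub> x = a \<odot>\<^bsub>M\<^esub> (b \<odot>\<^bsub>M\<^esub> x)"
    and smult_one [simp]:
      "x \<in> carrier M \<Longrightarrow> \<one>\<^bsub>R\<^esub> \<odot>\<^bsub>M\<^esub> x = x"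

definition lmod_hom ::
  "('r, 's) ring_scheme \<Rightarrow> ('r, 'm) module \<Rightarrow> ('r, 'n) module \<Rightarrow> ('m \<Rightarrow> 'n) set"
  where "lmod_hom R M N = {f \<in> carrier M \<rightarrow> carrier N.
    (\<forall>x\<in>carrier M. \<forall>y\<in>carrier M. f (x \<oplus>\<^bsub>M\<^esub> y) = f x \<oplus>\<^bsub>N\<^esub> f y) \<and>
    (\<forall>a\<in>carrier R. \<forall>x\<in>carrier M. f (a \<odot>\<^bsub>M\<^esub> x) = a \<odot>\<^bsub>N\<^esub> f x)}"

definition lmod_isomorphic ::
  "('r, 's) ring_scheme \<Rightarrow> ('r, 'm) module \<Rightarrow> ('r, 'n) module \<Rightarrow> bool"
  where "lmod_isomorphic R M N \<longleftrightarrow> (\<exists>f\<in>lmod_hom R M N. bij_betw f (carrier M) (carrier N))"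

text \<open>Members of \<open>lmod_hom\<close> are arbitrary outside the carrier, so a homomorphism is zero
  when it vanishes on the carrier.\<close>

definition hom_zero ::
  "('r, 's) ring_scheme \<Rightarrow> ('r, 'm) module \<Rightarrow> ('r, 'n) module \<Rightarrow> bool"
  where "hom_zero R M N \<longleftrightarrow> (\<forall>f\<in>lmod_hom R M N. \<forall>x\<in>carrier M. f x = \<zero>\<^bsub>N\<^esub>)"

definition lmod_quot :: "('r, 'm) module \<Rightarrow> 'm set \<Rightarrow> ('r, 'm set) module"
  where "lmod_quot M H =
    \<lparr>carrier = a_rcosets\<^bsub>M\<^esub> H, monoid.mult = undefined, one = undefined,
     zero = H, add = (<+>\<^bsub>M\<^esub>), smult = (\<lambda>a U. \<Union>x\<in>U. H +>\<^bsub>M\<^esub> (a \<odot>\<^bsub>M\<^esub> x))\<rparr>"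

definition lmod_sum :: "('r, 'm) module \<Rightarrow> ('r, 'n) module \<Rightarrow> ('r, 'm \<times> 'n) module"
  where "lmod_sum M N =
    \<lparr>carrier = carrier M \<times> carrier N, monoid.mult = undefined, one = undefined,
     zero = (\<zero>\<^bsub>M\<^esub>, \<zero>\<^bsub>N\<^esub>), add = (\<lambda>(x, y) (x', y'). (x \<oplus>\<^bsub>M\<^esub> x', y \<oplus>\<^bsub>N\<^esub> y')),
     smult = (\<lambda>a (x, y). (a \<odot>\<^bsub>M\<^esub> x, a \<odot>\<^bsub>N\<^esub> y))\<rparr>"

text \<open>The free left module of rank \<open>n\<close>.\<close>

definition free_lmod :: "('r, 's) ring_scheme \<Rightarrow> nat \<Rightarrow> ('r, nat \<Rightarrow> 'r) module"
  where "free_lmod R n =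
    \<lparr>carrier = {..<n} \<rightarrow>\<^sub>E carrier R, monoid.mult = undefined, one = undefined,
     zero = (\<lambda>i\<in>{..<n}. \<zero>\<^bsub>R\<^esub>), add = (\<lambda>x y. \<lambda>i\<in>{..<n}. x i \<oplus>\<^bsub>R\<^esub> y i),
     smult = (\<lambda>a x. \<lambda>i\<in>{..<n}. a \<otimes>\<^bsub>R\<^esub> x i)\<rparr>"

text \<open>Existence of an exact sequence \<open>R\<^sup>m \<rightarrow> R\<^sup>n \<rightarrow> M \<rightarrow> 0\<close>.\<close>

definition finitely_presented :: "('r, 's) ring_scheme \<Rightarrow> ('r, 'm) module \<Rightarrow> bool"
  where "finitely_presented R M \<longleftrightarrow>
    (\<exists>m n. \<exists>f\<in>lmod_hom R (free_lmod R m) (free_lmod R n). \<exists>g\<in>lmod_hom R (free_lmod R n) M.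
      f ` carrier (free_lmod R m) = a_kernel (free_lmod R n) M g \<and>
      g ` carrier (free_lmod R n) = carrier M)"

definition division_ring :: "('a, 'b) ring_scheme \<Rightarrow> bool"
  where "division_ring K \<longleftrightarrow> ring K \<and> \<one>\<^bsub>K\<^esub> \<noteq> \<zero>\<^bsub>K\<^esub> \<and> Units K = carrier K - {\<zero>\<^bsub>K\<^esub>}"

definition lmod_End :: "('r, 's) ring_scheme \<Rightarrow> ('r, 'm) module \<Rightarrow> ('m \<Rightarrow> 'm) ring"
  where "lmod_End R M =
    \<lparr>carrier = lmod_hom R M M \<inter> extensional (carrier M),
     monoid.mult = compose (carrier M), one = (\<lambda>x\<in>carrier M. x),
     zero = (\<lambda>x\<in>carrier M. \<zero>\<^bsub>M\<^esub>), add = (\<lambda>f g. \<lambda>x\<in>carrier M. f x \<oplus>\<^bsub>M\<^esub> g x)\<rparr>"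

definition brick :: "('r, 's) ring_scheme \<Rightarrow> ('r, 'm) module \<Rightarrow> bool"
  where "brick R M \<longleftrightarrow>
    left_module R M \<and> finitely_presented R M \<and> division_ring (lmod_End R M)"

definition orthogonal_bricks ::
  "('r, 's) ring_scheme \<Rightarrow> ('r, 'm) module \<Rightarrow> ('r, 'n) module \<Rightarrow> bool"
  where "orthogonal_bricks R M N \<longleftrightarrow>
    brick R M \<and> brick R N \<and> \<not> lmod_isomorphic R M N \<and> hom_zero R M N \<and> hom_zero R N M"

text \<open>A class of finitely presented, pairwise non-isomorphic modules is a set, so it can be
  represented by a HOL set of modules over one carrier type.\<close>

definition semibrick :: "('r, 's) ring_scheme \<Rightarrow> ('r, 'x) module set \<Rightarrow> bool"
  where "semibrick R \<X> \<longleftrightarrow> (\<forall>M\<in>\<X>. brick R M) \<and>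
    (\<forall>M\<in>\<X>. \<forall>N\<in>\<X>. M \<noteq> N \<longrightarrow> orthogonal_bricks R M N)"

text \<open>A chain \<open>(M\<^sub>\<lambda>, \<lambda> \<le> \<mu>)\<close> is indexed by a well-order \<open>r\<close> with a greatest element, which
  plays the role of the ordinal \<open>\<mu> + 1\<close>; its greatest element is \<open>\<mu>\<close>.\<close>

definition wo_suc :: "'i rel \<Rightarrow> 'i \<Rightarrow> 'i \<Rightarrow> bool"
  where "wo_suc r i j \<longleftrightarrow> i \<in> Field r \<and> j \<in> Field r \<and> underS r j = under r i"

definition wo_limit :: "'i rel \<Rightarrow> 'i \<Rightarrow> bool"
  where "wo_limit r j \<longleftrightarrow> j \<in> Field r \<and> underS r j \<noteq> {} \<and> (\<nexists>i. wo_suc r i j)"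

definition filtration ::
  "('r, 's) ring_scheme \<Rightarrow> ('r, 'm) module \<Rightarrow> 'i rel \<Rightarrow> ('i \<Rightarrow> 'm set) \<Rightarrow> bool"
  where "filtration R M r F \<longleftrightarrow> Well_order r \<and>
    (\<forall>i\<in>Field r. submodule (F i) R M) \<and>
    (\<forall>i j. (i, j) \<in> r \<longrightarrow> F i \<subseteq> F j) \<and>
    (\<forall>i\<in>Field r. underS r i = {} \<longrightarrow> F i = {\<zero>\<^bsub>M\<^esub>}) \<and>
    (\<exists>i\<in>Field r. aboveS r i = {} \<and> F i = carrier M) \<and>
    (\<forall>j. wo_limit r j \<longrightarrow> F j = (\<Union>i\<in>underS r j. F i))"

definition class_filtration ::
  "('r, 's) ring_scheme \<Rightarrow> ('r, 'x) module set \<Rightarrow> ('r, 'm) module \<Rightarrow> 'i rel \<Rightarrow> ('i \<Rightarrow> 'm set) \<Rightarrow> bool"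
  where "class_filtration R \<X> M r F \<longleftrightarrow> filtration R M r F \<and>
    (\<forall>i j. wo_suc r i j \<longrightarrow>
      (\<exists>X\<in>\<X>. lmod_isomorphic R (lmod_quot (M\<lparr>carrier := F j\<rparr>) (F i)) X))"

text \<open>HOL cannot quantify over index types. Well-orders on the type \<open>'m set\<close> suffice for
  filtrations of arbitrary ordinal length; see lemma \<open>Filt_if_class_filtration\<close> below.\<close>

definition Filt ::
  "('r, 's) ring_scheme \<Rightarrow> ('r, 'x) module set \<Rightarrow> ('r, 'm) module set"
  where "Filt R \<X> = {M. left_module R M \<and>
    (\<exists>(r :: 'm set rel) F. class_filtration R \<X> M r F)}"

lemma Filt_if_class_filtration:
  fixes r :: "'i rel" and M :: "('r, 'm) module"
  assumes M: "left_module R M" and cf: "class_filtration R \<X> M r F"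
  shows "M \<in> Filt R \<X>"
proof -
  have "filtration R M r F"
    and fac: "\<And>i j. wo_suc r i j \<Longrightarrow>
      \<exists>X\<in>\<X>. lmod_isomorphic R (lmod_quot (M\<lparr>carrier := F j\<rparr>) (F i)) X"
    using cf unfolding class_filtration_def by simp_all
  note filt = this(1)[unfolded filtration_def]
  have wo: "Well_order r" using filt by (elim conjE)
  have sub: "submodule (F i) R M" if "i \<in> Field r" for i using filt that by (elim conjE) (rule bspec)
  have mono: "F i \<subseteq> F j" if "(i, j) \<in> r" for i j using filt that by (elim conjE) iprover
  have bot: "F i = {\<zero>\<^bsub>M\<^esub>}" if "i \<in> Field r" "underS r i = {}" for i
    using filt that by (elim conjE) (drule (1) bspec, iprover)
  have top: "\<exists>i\<in>Field r. aboveS r i = {} \<and> F i = carrier M" using filt by (elim conjE)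
  have lim: "F j = (\<Union>i\<in>underS r j. F i)" if "wo_limit r j" for j
    using filt that by (elim conjE) iprover
  have lin: "(i, j) \<in> r \<or> (j, i) \<in> r" if "i \<in> Field r" "j \<in> Field r" for i j
    using wo that unfolding well_order_on_def linear_order_on_def partial_order_on_def
      preorder_on_def total_on_def refl_on_def by metis
  have wf: "wf (r - Id)" using wo unfolding well_order_on_def by blast
  have minimal: "\<exists>i\<in>I. \<forall>k\<in>I. (i, k) \<in> r" if "I \<subseteq> Field r" "I \<noteq> {}" for I
  proof -
    obtain i where "i \<in> I" "\<And>k. (k, i) \<in> r - Id \<Longrightarrow> k \<notin> I"
      using wf \<open>I \<noteq> {}\<close> unfolding wf_eq_minimal by (metis ex_in_conv)
    then show ?thesis using lin that(1) by (metis DiffI pair_in_Id_conv subsetD)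
  qed
  define J where "J = F ` Field r"
  define r' where "r' = {(A, B). A \<in> J \<and> B \<in> J \<and> A \<subseteq> B}"
  have Field: "Field r' = J" unfolding r'_def Field_def by auto
  have under: "under r' A = {B\<in>J. B \<subseteq> A}" if "A \<in> J" for A
    using that unfolding under_def r'_def by auto
  have underS: "underS r' A = {B\<in>J. B \<subset> A}" if "A \<in> J" for A
    using that unfolding underS_def r'_def by auto
  have chain: "A \<subseteq> B \<or> B \<subseteq> A" if "A \<in> J" "B \<in> J" for A B
    using that lin mono unfolding J_def by blast
  have wf': "wf (r' - Id)"
    unfolding wf_eq_minimal
  proof (intro allI impI)
    fix Q and A :: "'m set" assume A: "A \<in> Q"
    show "\<exists>Z\<in>Q. \<forall>Y. (Y, Z) \<in> r' - Id \<longrightarrow> Y \<notin> Q"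
    proof (cases "{i\<in>Field r. F i \<in> Q} = {}")
      case True
      then show ?thesis using A unfolding r'_def J_def by blast
    next
      case False
      then obtain i where i: "i \<in> Field r" "F i \<in> Q"
        and least: "\<And>k. k \<in> Field r \<Longrightarrow> F k \<in> Q \<Longrightarrow> (i, k) \<in> r"
        using minimal[of "{i\<in>Field r. F i \<in> Q}"] by auto
      have "Y \<notin> Q" if Y: "(Y, F i) \<in> r' - Id" for Y
      proof
        assume "Y \<in> Q"
        obtain k where k: "k \<in> Field r" "Y = F k" using Y unfolding r'_def J_def by auto
        have "F i \<subseteq> Y" using mono[OF least[OF k(1)]] k(2) \<open>Y \<in> Q\<close> by simp
        then show False using Y unfolding r'_def by auto
      qed
      then show ?thesis using i(2) by blast
    qed
  qed
  have wo': "Well_order r'"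
    unfolding well_order_on_def linear_order_on_def partial_order_on_def preorder_on_def Field
  proof (intro conjI wf')
    show "refl_on J r'" by (auto simp: refl_on_def r'_def)
    show "trans r'" by (auto simp: trans_def r'_def)
    show "antisym r'" by (auto simp: antisym_def r'_def)
    show "total_on J r'" using chain by (auto simp: total_on_def r'_def)
  qed (auto simp: r'_def)
  have lim': "B = (\<Union>A\<in>underS r' B. A)" if B: "wo_limit r' B" for B
  proof -
    have BJ: "B \<in> J" using B Field unfolding wo_limit_def by blast
    then have "{i\<in>Field r. F i = B} \<noteq> {}" unfolding J_def by auto
    then obtain j where j: "j \<in> Field r" "F j = B"
      and least: "\<And>k. k \<in> Field r \<Longrightarrow> F k = B \<Longrightarrow> (j, k) \<in> r"
      using minimal[of "{i\<in>Field r. F i = B}"] by auto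
    have strict: "F k \<subset> B" "F k \<in> J" if "k \<in> underS r j" for k
    proof -
      have k: "(k, j) \<in> r" "k \<noteq> j" "k \<in> Field r" using that unfolding underS_def Field_def by auto
      have "(j, k) \<notin> r"
        using k wo unfolding well_order_on_def linear_order_on_def partial_order_on_def antisym_def
        by blast
      then show "F k \<subset> B" using least[OF k(3)] mono[OF k(1)] j(2) by auto
      show "F k \<in> J" using k unfolding J_def by blast
    qed
    have "underS r j \<noteq> {}"
    proof
      assume "underS r j = {}"
      then have "B = {\<zero>\<^bsub>M\<^esub>}" using bot j by blast
      moreover obtain i where "i \<in> Field r" "F i \<subset> B"
        using B underS[OF BJ] unfolding wo_limit_def J_def by auto
      moreover have "\<zero>\<^bsub>M\<^esub> \<in> F i"
        using sub[OF \<open>i \<in> Field r\<close>] subgroup.one_closed[of "F i" "add_monoid M"]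
        unfolding submodule_def by simp
      ultimately show False by blast
    qed
    moreover have "\<not> wo_suc r i j" for i
    proof
      assume s: "wo_suc r i j"
      then have i: "i \<in> Field r" "underS r j = under r i" unfolding wo_suc_def by auto
      have "i \<in> under r i" using lin[of i i] i unfolding under_def by blast
      then have ij: "F i \<subset> B" "F i \<in> J" using strict i by auto
      have "A \<subseteq> F i" if A: "A \<in> J" "A \<subset> B" for A
      proof -
        obtain k where k: "k \<in> Field r" "A = F k" using A unfolding J_def by auto
        then have "(j, k) \<notin> r" using mono[of j k] j(2) A(2) by auto
        then have "k \<in> underS r j" using lin[OF k(1) j(1)] unfolding underS_def by auto
        then have "(k, i) \<in> r" using i(2) unfolding under_def by simp
        then show ?thesis using mono k(2) by simp
      qed
      then have "wo_suc r' (F i) B"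
        using ij BJ unfolding wo_suc_def Field under[OF ij(2)] underS[OF BJ] by auto
      then show False using B unfolding wo_limit_def by blast
    qed
    ultimately have "B = (\<Union>i\<in>underS r j. F i)"
      using lim j unfolding wo_limit_def by metis
    moreover have "(\<Union>i\<in>underS r j. F i) \<subseteq> (\<Union>A\<in>underS r' B. A)"
      by (rule UN_least, rule UN_upper) (simp add: underS[OF BJ] strict)
    moreover have "(\<Union>A\<in>underS r' B. A) \<subseteq> B" unfolding underS[OF BJ] by auto
    ultimately show ?thesis by simp
  qed
  have fac': "\<exists>X\<in>\<X>. lmod_isomorphic R (lmod_quot (M\<lparr>carrier := B\<rparr>) A) X"
    if AB: "wo_suc r' A B" for A B
  proof -
    have J: "A \<in> J" "B \<in> J" and nxt: "{C\<in>J. C \<subset> B} = {C\<in>J. C \<subseteq> A}"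
      using AB under[of A] underS[of B] unfolding wo_suc_def Field by simp_all
    have "A \<subset> B" using nxt J by blast
    obtain b where "b \<in> Field r" "F b = B" using J unfolding J_def by auto
    then have "{k\<in>Field r. \<not> F k \<subseteq> A} \<noteq> {}" using \<open>A \<subset> B\<close> by auto
    then obtain j where j: "j \<in> Field r" "\<not> F j \<subseteq> A"
      and least: "\<And>k. k \<in> Field r \<Longrightarrow> \<not> F k \<subseteq> A \<Longrightarrow> (j, k) \<in> r"
      using minimal[of "{k\<in>Field r. \<not> F k \<subseteq> A}"] by auto
    have "F j \<subseteq> B"
      using mono[OF least[OF \<open>b \<in> Field r\<close>]] \<open>F b = B\<close> \<open>A \<subset> B\<close> by auto
    moreover have "F j \<in> J" using j(1) unfolding J_def by simp
    ultimately have Fj: "F j = B" using nxt j(2) by blast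
    obtain a where a: "a \<in> Field r" "F a = A" using J unfolding J_def by auto
    have below: "F k \<subseteq> A" if "k \<in> underS r j" for k
    proof -
      have k: "(k, j) \<in> r" "k \<noteq> j" "k \<in> Field r" using that unfolding underS_def Field_def by auto
      have "(j, k) \<notin> r"
        using k wo unfolding well_order_on_def linear_order_on_def partial_order_on_def antisym_def
        by blast
      then show ?thesis using least k by blast
    qed
    have aj: "a \<in> underS r j"
      using lin[OF a(1) j(1)] mono[of j a] a(2) j(2) unfolding underS_def by auto
    obtain i where i: "wo_suc r i j"
    proof (rule ccontr)
      assume "\<not> thesis"
      then have "wo_limit r j" using that j(1) aj unfolding wo_limit_def by auto
      then have "F j \<subseteq> A" using lim below by auto
      then show False using j(2) by contradiction
    qed
    have "F i = A"
    proof -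
      have ir: "i \<in> Field r" "underS r j = under r i" using i unfolding wo_suc_def by auto
      have "i \<in> under r i" using lin[of i i] ir unfolding under_def by blast
      then have "F i \<subseteq> A" using below ir by blast
      moreover have "(a, i) \<in> r" using aj ir(2) unfolding under_def by simp
      then have "A \<subseteq> F i" using mono a(2) by auto
      ultimately show ?thesis by blast
    qed
    then show ?thesis using fac[OF i] Fj by simp
  qed
  obtain t where t: "t \<in> Field r" "F t = carrier M" using top by blast
  have le_carrier: "A \<subseteq> carrier M" if "A \<in> J" for A
    using that sub subgroup.subset unfolding J_def submodule_def by fastforce
  have zero_in: "{\<zero>\<^bsub>M\<^esub>} \<in> J" and zero_le: "\<And>A. A \<in> J \<Longrightarrow> {\<zero>\<^bsub>M\<^esub>} \<subseteq> A"
  proof -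
    obtain z where z: "z \<in> Field r" "\<And>k. k \<in> Field r \<Longrightarrow> (z, k) \<in> r"
      using minimal[of "Field r"] t by auto
    have "underS r z = {}"
      using z wo unfolding underS_def well_order_on_def linear_order_on_def partial_order_on_def
        antisym_def Field_def by blast
    then have "F z = {\<zero>\<^bsub>M\<^esub>}" using bot z by blast
    then show "{\<zero>\<^bsub>M\<^esub>} \<in> J" using z(1) unfolding J_def by (metis image_eqI)
    show "{\<zero>\<^bsub>M\<^esub>} \<subseteq> A" if "A \<in> J" for A
      using that z(2) mono[of z] \<open>F z = {\<zero>\<^bsub>M\<^esub>}\<close> unfolding J_def by fastforce
  qed
  have "class_filtration R \<X> M r' (\<lambda>A. A)"
    unfolding class_filtration_def filtration_def
  proof (intro conjI allI impI ballI)
    show "\<exists>A\<in>Field r'. aboveS r' A = {} \<and> A = carrier M"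
    proof (intro bexI conjI)
      show "carrier M \<in> Field r'" using t unfolding Field J_def by (metis image_eqI)
      show "aboveS r' (carrier M) = {}" using le_carrier unfolding aboveS_def r'_def by auto
    qed simp
    show "A = {\<zero>\<^bsub>M\<^esub>}" if "A \<in> Field r'" "underS r' A = {}" for A
      using that zero_in zero_le[of A] underS[of A] unfolding Field by blast
    show "submodule A R M" if "A \<in> Field r'" for A using that sub unfolding Field J_def by blast
    show "A \<subseteq> B" if "(A, B) \<in> r'" for A B using that unfolding r'_def by blast
  qed (fact wo' lim' fac')+
  then show ?thesis unfolding Filt_def using M by blast
qed

text \<open>The category of left \<open>R\<close>-modules is represented by the modules with carrier in a type
  \<open>'m\<close>, and a full subcategory by its set \<open>\<C>\<close> of objects. As \<open>'m\<close> is arbitrary,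
  modules of every size are covered. Closure is required for every representative in \<open>'m\<close>
  of the kernel, cokernel or direct sum.\<close>

definition abelian_subcategory ::
  "('r, 's) ring_scheme \<Rightarrow> ('r, 'm) module set \<Rightarrow> bool"
  where "abelian_subcategory R \<C> \<longleftrightarrow>
    (\<forall>M\<in>\<C>. left_module R M) \<and>
    (\<forall>Z. left_module R Z \<and> carrier Z = {\<zero>\<^bsub>Z\<^esub>} \<longrightarrow> Z \<in> \<C>) \<and>
    (\<forall>M\<in>\<C>. \<forall>N\<in>\<C>. \<forall>S. left_module R S \<and> lmod_isomorphic R S (lmod_sum M N) \<longrightarrow> S \<in> \<C>) \<and>
    (\<forall>M\<in>\<C>. \<forall>N\<in>\<C>. \<forall>f\<in>lmod_hom R M N. \<forall>K.
      left_module R K \<and> lmod_isomorphic R K (M\<lparr>carrier := a_kernel M N f\<rparr>) \<longrightarrow> K \<in> \<C>) \<and>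
    (\<forall>M\<in>\<C>. \<forall>N\<in>\<C>. \<forall>f\<in>lmod_hom R M N. \<forall>C.
      left_module R C \<and> lmod_isomorphic R C (lmod_quot N (f ` carrier M)) \<longrightarrow> C \<in> \<C>)"

definition extension_closed ::
  "('r, 's) ring_scheme \<Rightarrow> ('r, 'm) module set \<Rightarrow> bool"
  where "extension_closed R \<C> \<longleftrightarrow>
    (\<forall>M\<in>\<C>. \<forall>N\<in>\<C>. \<forall>E. \<forall>f\<in>lmod_hom R M E. \<forall>g\<in>lmod_hom R E N.
      left_module R E \<and> inj_on f (carrier M) \<and> f ` carrier M = a_kernel E N g \<and>
      g ` carrier E = carrier N \<longrightarrow> E \<in> \<C>)"

definition wide_subcategory ::
  "('r, 's) ring_scheme \<Rightarrow> ('r, 'm) module set \<Rightarrow> bool"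
  where "wide_subcategory R \<C> \<longleftrightarrow> abelian_subcategory R \<C> \<and> extension_closed R \<C>"

end

theory Submission
  imports Defs
begin

text \<open>Call a module good if every nonzero homomorphism from a brick in \<open>\<X>\<close> to it is injective with
  good cokernel (coinductively). Filtered modules are good: the image of a brick is finitely
  generated, so it first appears at a successor step of the filtration, where by orthogonality it
  splits off. Since the bricks are finitely presented, goodness of quotients passes to unions of
  chains. Hence, if \<open>f : M \<rightarrow> N\<close> with \<open>M\<close> filtered by \<open>M\<^sub>\<lambda>\<close> and \<open>N\<close> good, transfinite induction
  shows that every \<open>N/f(M\<^sub>\<lambda>)\<close> is good and that every step \<open>M\<^sub>\<lambda>\<^sub>+\<^sub>1/M\<^sub>\<lambda> \<rightarrow> N/f(M\<^sub>\<lambda>)\<close> is zero or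
  injective. So the filtrations of \<open>M\<close> and \<open>N\<close> induce filtrations of the kernel and the cokernel
  of \<open>f\<close> in which each factor is either zero or unchanged.\<close>

section \<open>Towers\<close>

text \<open>The obvious induction would carry "\<open>N/f(M\<^sub>\<lambda>)\<close> is filtered"
  along the chain. It breaks at limits: the filtrations at different stages are unrelated, so
  nothing filters their direct limit. Goodness is weaker and survives, because it only speaks of
  homomorphisms from finitely presented modules. It is coinductive because a successor step passes
  to a further quotient, of which the same is needed again. For the cokernel, goodness of
  \<open>N/f(M)\<close> alone gives no filtration. Instead every \<open>N/N\<^sub>\<lambda>\<close>
  is good, being filtered, hence so is \<open>N/(N\<^sub>\<lambda> + f(M))\<close>, and goodness of
  this module decides what becomes of the step from \<open>N\<^sub>\<lambda>\<close> to
  \<open>N\<^sub>\<lambda>\<^sub>+\<^sub>1\<close>. Quotients are kept implicit: iterated quotients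
  would have carriers of ever new types, so chains, factors and goodness are phrased with submodules
  of one fixed module.\<close>

text \<open>A filtration is encoded by the set of its members. Closure under intersection makes it
  well-ordered by inclusion, and \<open>Q\<close> is the condition on successive members.\<close>

definition tower :: "('a set \<Rightarrow> 'a set \<Rightarrow> bool) \<Rightarrow> 'a set set \<Rightarrow> 'a set \<Rightarrow> 'a set \<Rightarrow> bool"
  where "tower Q \<C> A B \<longleftrightarrow> A \<in> \<C> \<and> B \<in> \<C> \<and> (\<forall>C\<in>\<C>. A \<subseteq> C \<and> C \<subseteq> B) \<and>
    (\<forall>\<D>. \<D> \<subseteq> \<C> \<and> \<D> \<noteq> {} \<longrightarrow> \<Inter>\<D> \<in> \<D>) \<and>
    (\<forall>C\<in>\<C>. C \<noteq> A \<longrightarrow> C = \<Union>{D\<in>\<C>. D \<subset> C} \<or>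
      (\<exists>D\<in>\<C>. Q D C \<and> D \<subset> C \<and> (\<forall>E\<in>\<C>. E \<subset> C \<longrightarrow> E \<subseteq> D)))"

lemma towerI:
  assumes "A \<in> \<C>" "B \<in> \<C>" "\<And>C. C \<in> \<C> \<Longrightarrow> A \<subseteq> C" "\<And>C. C \<in> \<C> \<Longrightarrow> C \<subseteq> B"
    and "\<And>\<D>. \<D> \<subseteq> \<C> \<Longrightarrow> \<D> \<noteq> {} \<Longrightarrow> \<Inter>\<D> \<in> \<D>"
    and "\<And>C. C \<in> \<C> \<Longrightarrow> C \<noteq> A \<Longrightarrow> C \<noteq> \<Union>{D\<in>\<C>. D \<subset> C} \<Longrightarrow>
      \<exists>D\<in>\<C>. Q D C \<and> D \<subset> C \<and> (\<forall>E\<in>\<C>. E \<subset> C \<longrightarrow> E \<subseteq> D)"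
  shows "tower Q \<C> A B"
  unfolding tower_def
proof (intro conjI ballI allI impI)
  fix C assume "C \<in> \<C>" "C \<noteq> A"
  then show "C = \<Union>{D\<in>\<C>. D \<subset> C} \<or>
      (\<exists>D\<in>\<C>. Q D C \<and> D \<subset> C \<and> (\<forall>E\<in>\<C>. E \<subset> C \<longrightarrow> E \<subseteq> D))"
    using assms(6)[of C] by (cases "C = \<Union>{D\<in>\<C>. D \<subset> C}") (rule disjI1, assumption, rule disjI2)
next
  show "\<Inter>\<D> \<in> \<D>" if "\<D> \<subseteq> \<C> \<and> \<D> \<noteq> {}" for \<D> using assms(5) that by (elim conjE)
qed (fact assms(1,2) | erule assms(3,4))+

section \<open>Order properties of towers and operations on them\<close>

context
  fixes Q \<C> and A B :: "'a set"
  assumes tower: "tower Q \<C> A B"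
begin

lemma tower_bot: "A \<in> \<C>" and tower_top: "B \<in> \<C>"
  and tower_ge: "C \<in> \<C> \<Longrightarrow> A \<subseteq> C" and tower_le: "C \<in> \<C> \<Longrightarrow> C \<subseteq> B"
  and tower_Inter: "\<D> \<subseteq> \<C> \<Longrightarrow> \<D> \<noteq> {} \<Longrightarrow> \<Inter>\<D> \<in> \<D>"
  using tower unfolding tower_def by simp_all

lemma tower_cases:
  assumes "C \<in> \<C>"
  obtains "C = A" | "C \<noteq> A" "C = \<Union>{D\<in>\<C>. D \<subset> C}"
  | D where "D \<in> \<C>" "Q D C" "D \<subset> C" "\<And>E. E \<in> \<C> \<Longrightarrow> E \<subset> C \<Longrightarrow> E \<subseteq> D"
proof -
  have "C = A \<or> C = \<Union>{D\<in>\<C>. D \<subset> C} \<or>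
      (\<exists>D\<in>\<C>. Q D C \<and> D \<subset> C \<and> (\<forall>E\<in>\<C>. E \<subset> C \<longrightarrow> E \<subseteq> D))"
    using tower assms unfolding tower_def by blast
  then show ?thesis using that by metis
qed

text \<open>The intersection of \<open>C\<close> and \<open>D\<close> is one of the two.\<close>

lemma tower_linear: "C \<in> \<C> \<Longrightarrow> D \<in> \<C> \<Longrightarrow> C \<subseteq> D \<or> D \<subseteq> C"
  using tower_Inter[of "{C, D}"] by auto

text \<open>Inclusion is well-founded on \<open>\<C>\<close>: the intersection of all members with
  property \<open>P\<close> is one of them.\<close>

lemma tower_least:
  assumes "C \<in> \<C>" "P C"
  obtains D where "D \<in> \<C>" "P D" "\<And>E. E \<in> \<C> \<Longrightarrow> P E \<Longrightarrow> D \<subseteq> E"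
proof -
  have "\<Inter>{C\<in>\<C>. P C} \<in> {C\<in>\<C>. P C}" using assms by (intro tower_Inter) auto
  then show ?thesis using that by blast
qed

text \<open>Transfinite induction by a least counterexample, which can be neither the bottom nor a
  successor nor a union of smaller members.\<close>

lemma tower_induct:
  assumes C: "C \<in> \<C>" and bot: "P A"
    and suc: "\<And>D C. D \<in> \<C> \<Longrightarrow> C \<in> \<C> \<Longrightarrow> Q D C \<Longrightarrow> P D \<Longrightarrow> P C"
    and lim: "\<And>C. C \<in> \<C> \<Longrightarrow> C \<noteq> A \<Longrightarrow> C = \<Union>{D\<in>\<C>. D \<subset> C} \<Longrightarrow>
      (\<And>D. D \<in> \<C> \<Longrightarrow> D \<subset> C \<Longrightarrow> P D) \<Longrightarrow> P C"
  shows "P C"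
proof (rule ccontr)
  assume "\<not> P C"
  from tower_least[of C "\<lambda>C. \<not> P C", OF C this] obtain D
    where D: "D \<in> \<C>" "\<not> P D" and least: "\<And>E. E \<in> \<C> \<Longrightarrow> \<not> P E \<Longrightarrow> D \<subseteq> E" by metis
  have P: "P E" if "E \<in> \<C>" "E \<subset> D" for E using least that by blast
  show False
    using D(1)
  proof (cases rule: tower_cases)
    case 1 then show False using bot D by simp
  next
    case 2 then show False using lim[OF D(1)] P D(2) by blast
  next
    case (3 E) then show False using suc[of E D] P D by blast
  qed
qed

lemma tower_below:
  assumes V: "V \<in> \<C>" shows "tower Q {C\<in>\<C>. C \<subseteq> V} A V"
proof (rule towerI)
  fix C assume C: "C \<in> {C\<in>\<C>. C \<subseteq> V}" "C \<noteq> A" "C \<noteq> \<Union>{D\<in>{C\<in>\<C>. C \<subseteq> V}. D \<subset> C}"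
  have "{D\<in>{C\<in>\<C>. C \<subseteq> V}. D \<subset> C} = {D\<in>\<C>. D \<subset> C}" using C(1) by auto
  with C(3) have lim: "C \<noteq> \<Union>{D\<in>\<C>. D \<subset> C}" by simp
  from C(1) have "C \<in> \<C>" by simp
  then show "\<exists>D\<in>{C\<in>\<C>. C \<subseteq> V}. Q D C \<and> D \<subset> C \<and> (\<forall>E\<in>{C\<in>\<C>. C \<subseteq> V}. E \<subset> C \<longrightarrow> E \<subseteq> D)"
  proof (cases rule: tower_cases)
    case (3 D)
    then show ?thesis using C(1) by (intro bexI[of _ D]) auto
  qed (use C(2) lim in simp_all)
next
  show "\<Inter>\<D> \<in> \<D>" if "\<D> \<subseteq> {C\<in>\<C>. C \<subseteq> V}" "\<D> \<noteq> {}" for \<D>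
    using that by (intro tower_Inter) auto
qed (use V tower_bot tower_ge in auto)

text \<open>Stands for the filtration induced on the quotient by \<open>V\<close>. A union of
  smaller members stays one after those below \<open>V\<close> are dropped, because \<open>V\<close>
  itself remains and contains them.\<close>

lemma tower_above:
  assumes V: "V \<in> \<C>" shows "tower Q {C\<in>\<C>. V \<subseteq> C} V B"
proof (rule towerI)
  fix C assume C: "C \<in> {C\<in>\<C>. V \<subseteq> C}" "C \<noteq> V" "C \<noteq> \<Union>{D\<in>{C\<in>\<C>. V \<subseteq> C}. D \<subset> C}"
  have VC: "C \<in> \<C>" "V \<subset> C" using C by auto
  from VC(1) show "\<exists>D\<in>{C\<in>\<C>. V \<subseteq> C}. Q D C \<and> D \<subset> C \<and> (\<forall>E\<in>{C\<in>\<C>. V \<subseteq> C}. E \<subset> C \<longrightarrow> E \<subseteq> D)"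
  proof (cases rule: tower_cases)
    case 1 then show ?thesis using VC V tower_ge by blast
  next
    case 2
    have "x \<in> \<Union>{D\<in>{C\<in>\<C>. V \<subseteq> C}. D \<subset> C}" if "x \<in> C" for x
    proof -
      obtain D where D: "D \<in> \<C>" "D \<subset> C" "x \<in> D" using 2(2) \<open>x \<in> C\<close> by blast
      from tower_linear[OF D(1) V] show ?thesis
      proof
        assume "D \<subseteq> V"
        then show ?thesis using D V VC by (intro UnionI[of V]) auto
      next
        assume "V \<subseteq> D"
        then show ?thesis using D by (intro UnionI[of D]) auto
      qed
    qed
    then have "C = \<Union>{D\<in>{C\<in>\<C>. V \<subseteq> C}. D \<subset> C}" by blast
    then show ?thesis using C(3) by contradiction
  next
    case (3 D)
    then show ?thesis using VC V by (intro bexI[of _ D]) auto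
  qed
next
  show "\<Inter>\<D> \<in> \<D>" if "\<D> \<subseteq> {C\<in>\<C>. V \<subseteq> C}" "\<D> \<noteq> {}" for \<D>
    using that by (intro tower_Inter) auto
qed (use V tower_top tower_le in auto)

text \<open>Images and preimages under homomorphisms are monotone and respect unions of chains, but
  may identify members. Hence \<open>Q'\<close> is asked for only where \<open>\<Phi>\<close>
  changes; this is what lets factors vanish in a kernel or a cokernel.\<close>

lemma tower_image:
  assumes mono: "\<And>C D. C \<in> \<C> \<Longrightarrow> D \<in> \<C> \<Longrightarrow> C \<subseteq> D \<Longrightarrow> \<Phi> C \<subseteq> \<Phi> D"
    and cont: "\<And>\<D>. \<D> \<subseteq> \<C> \<Longrightarrow> \<D> \<noteq> {} \<Longrightarrow> \<Phi> (\<Union>\<D>) \<subseteq> (\<Union>D\<in>\<D>. \<Phi> D)"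
    and step: "\<And>C D. C \<in> \<C> \<Longrightarrow> D \<in> \<C> \<Longrightarrow> Q C D \<Longrightarrow> C \<subset> D \<Longrightarrow> \<Phi> C \<noteq> \<Phi> D \<Longrightarrow> Q' (\<Phi> C) (\<Phi> D)"
  shows "tower Q' (\<Phi> ` \<C>) (\<Phi> A) (\<Phi> B)"
proof (rule towerI)
  fix \<D> assume \<D>: "\<D> \<subseteq> \<Phi> ` \<C>" "\<D> \<noteq> {}"
  then obtain C where "C \<in> \<C>" "\<Phi> C \<in> \<D>" by blast
  from tower_least[of C "\<lambda>C. \<Phi> C \<in> \<D>", OF this] obtain C
    where C: "C \<in> \<C>" "\<Phi> C \<in> \<D>" "\<And>E. E \<in> \<C> \<Longrightarrow> \<Phi> E \<in> \<D> \<Longrightarrow> C \<subseteq> E" by metis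
  then have "\<Phi> C \<subseteq> D" if "D \<in> \<D>" for D using that \<D>(1) mono by blast
  then have "\<Inter>\<D> = \<Phi> C" using C(2) by blast
  then show "\<Inter>\<D> \<in> \<D>" using C(2) by simp
next
  fix D assume D: "D \<in> \<Phi> ` \<C>" "D \<noteq> \<Phi> A" "D \<noteq> \<Union>{E\<in>\<Phi> ` \<C>. E \<subset> D}"
  from D(1) obtain C where "C \<in> \<C>" "\<Phi> C = D" by blast
  \<comment> \<open>Each member of the image is represented by its least preimage. Everything below
    that one has a strictly smaller image, so a predecessor is mapped to a predecessor and a union
    to a union.\<close>
  from tower_least[of C "\<lambda>C. \<Phi> C = D", OF this] obtain C
    where C: "C \<in> \<C>" "\<Phi> C = D" and least: "\<And>E. E \<in> \<C> \<Longrightarrow> \<Phi> E = D \<Longrightarrow> C \<subseteq> E" by metis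
  have below: "\<Phi> E \<subset> D" if "E \<in> \<C>" "E \<subset> C" for E using that mono[of E C] C least[of E] by blast
  from C(1) show "\<exists>E\<in>\<Phi> ` \<C>. Q' E D \<and> E \<subset> D \<and> (\<forall>E'\<in>\<Phi> ` \<C>. E' \<subset> D \<longrightarrow> E' \<subseteq> E)"
  proof (cases rule: tower_cases)
    case 1 then show ?thesis using C(2) D(2) by simp
  next
    case 2
    have "A \<subset> C" using tower_ge[OF C(1)] 2(1) by blast
    then have "\<Phi> (\<Union>{E\<in>\<C>. E \<subset> C}) \<subseteq> (\<Union>E\<in>{E\<in>\<C>. E \<subset> C}. \<Phi> E)"
      using tower_bot by (intro cont) auto
    also have "\<dots> \<subseteq> \<Union>{E\<in>\<Phi> ` \<C>. E \<subset> D}" using below by blast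
    finally have "D \<subseteq> \<Union>{E\<in>\<Phi> ` \<C>. E \<subset> D}" using 2(2) C(2) by simp
    then have "D = \<Union>{E\<in>\<Phi> ` \<C>. E \<subset> D}" by blast
    then show ?thesis using D(3) by contradiction
  next
    case (3 E)
    have "\<Phi> E' \<subseteq> \<Phi> E" if "E' \<in> \<C>" "\<Phi> E' \<subset> D" for E'
    proof -
      have "\<not> C \<subseteq> E'" using mono[OF C(1) that(1)] that(2) C(2) by blast
      then have "E' \<subset> C" using tower_linear[OF C(1) that(1)] by blast
      then show ?thesis using 3(4)[OF that(1)] mono that(1) 3(1) by blast
    qed
    moreover have "Q' (\<Phi> E) D" using step[OF 3(1) C(1) 3(2,3)] below[OF 3(1,3)] C(2) by simp
    ultimately show ?thesis using 3(1) below[OF 3(1,3)] by (intro bexI[of _ "\<Phi> E"]) auto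
  qed
next
  show "\<Phi> A \<subseteq> D" if "D \<in> \<Phi> ` \<C>" for D using that mono[OF tower_bot] tower_ge by auto
  show "D \<subseteq> \<Phi> B" if "D \<in> \<Phi> ` \<C>" for D using that mono[OF _ tower_top] tower_le by auto
qed (use tower_bot tower_top in simp_all)

end

text \<open>Every member of \<open>\<C>\<close> lies below every member of \<open>\<D>\<close>, with
  \<open>B\<close> in common. In terms of modules, a filtration of a submodule is continued by one
  of the quotient by it.\<close>

lemma tower_append:
  assumes \<C>: "tower Q \<C> A B" and \<D>: "tower Q \<D> B C"
  shows "tower Q (\<C> \<union> \<D>) A C"
proof (rule towerI)
  have le: "D \<subseteq> E" if "D \<in> \<C>" "E \<in> \<D>" for D E
    using that tower_le[OF \<C>] tower_ge[OF \<D>] by blast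
  show "A \<in> \<C> \<union> \<D>" "C \<in> \<C> \<union> \<D>" using tower_bot[OF \<C>] tower_top[OF \<D>] by auto
  show "A \<subseteq> D" if "D \<in> \<C> \<union> \<D>" for D using that tower_ge[OF \<C>] le[OF tower_bot[OF \<C>]] by blast
  show "D \<subseteq> C" if "D \<in> \<C> \<union> \<D>" for D using that tower_le[OF \<D>] le[OF _ tower_top[OF \<D>]] by blast
  show "\<Inter>\<E> \<in> \<E>" if \<E>: "\<E> \<subseteq> \<C> \<union> \<D>" "\<E> \<noteq> {}" for \<E>
  proof (cases "\<E> \<inter> \<C> = {}")
    case True
    then show ?thesis using \<E> tower_Inter[OF \<D>, of \<E>] by blast
  next
    case False
    have "\<Inter>(\<E> \<inter> \<C>) \<in> \<E> \<inter> \<C>" using False by (intro tower_Inter[OF \<C>]) auto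
    moreover from this have "\<Inter>(\<E> \<inter> \<C>) \<subseteq> E" if "E \<in> \<E>" for E
      using that \<E>(1) le[of _ E] by blast
    ultimately have "\<Inter>\<E> = \<Inter>(\<E> \<inter> \<C>)" by blast
    then show ?thesis using \<open>\<Inter>(\<E> \<inter> \<C>) \<in> \<E> \<inter> \<C>\<close> by simp
  qed
  fix D assume D: "D \<in> \<C> \<union> \<D>" "D \<noteq> A" "D \<noteq> \<Union>{E\<in>\<C> \<union> \<D>. E \<subset> D}"
  have upper: "\<Union>{E\<in>\<C> \<union> \<D>. E \<subset> D} \<subseteq> D" by auto
  show "\<exists>E\<in>\<C> \<union> \<D>. Q E D \<and> E \<subset> D \<and> (\<forall>E'\<in>\<C> \<union> \<D>. E' \<subset> D \<longrightarrow> E' \<subseteq> E)"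
  proof (cases "D \<in> \<C>")
    case True
    then show ?thesis
    proof (cases rule: tower_cases[OF \<C>, consumes 1])
      case 2
      have "\<Union>{E\<in>\<C>. E \<subset> D} \<subseteq> \<Union>{E\<in>\<C> \<union> \<D>. E \<subset> D}" by (rule Union_mono) auto
      then show ?thesis using D(3) 2(2) upper by blast
    next
      case (3 E)
      then show ?thesis using le[OF True] by (intro bexI[of _ E]) auto
    qed (use D(2) in simp)
  next
    case False
    then have "D \<in> \<D>" "D \<noteq> B" using D(1) tower_top[OF \<C>] by auto
    from this(1) show ?thesis
    proof (cases rule: tower_cases[OF \<D>, consumes 1])
      case 2
      have "\<Union>{E\<in>\<D>. E \<subset> D} \<subseteq> \<Union>{E\<in>\<C> \<union> \<D>. E \<subset> D}" by (rule Union_mono) auto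
      then show ?thesis using D(3) 2(2) upper by blast
    next
      case (3 E)
      then show ?thesis using le[of _ E] by (intro bexI[of _ E]) auto
    qed (use \<open>D \<noteq> B\<close> in simp)
  qed
qed

lemma tower_singleton: "tower Q {A} A A"
proof (rule towerI)
  show "\<Inter>\<D> \<in> \<D>" if "\<D> \<subseteq> {A}" "\<D> \<noteq> {}" for \<D>
    using that by (simp add: subset_singleton_iff)
qed simp_all

section \<open>Submodules and homomorphisms\<close>

text \<open>Two decompositions of one element along two submodules differ by an element of both.
  Maps defined through such decompositions are well defined for this reason.\<close>

lemma (in abelian_group) diff_eq_diff:
  assumes "v \<in> carrier G" "w \<in> carrier G" "x \<in> carrier G" "y \<in> carrier G"
    and "v \<oplus> x = w \<oplus> y"
  shows "x \<ominus> y = w \<ominus> v"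
proof -
  have "x \<ominus> y = (v \<oplus> x) \<oplus> (\<ominus> v \<oplus> \<ominus> y)"
    using assms(1-4) by (simp add: minus_eq a_lcomm[of "x" "\<ominus> v"] a_assoc r_neg2)
  also have "\<dots> = (w \<ominus> v) \<oplus> (y \<oplus> \<ominus> y)"
    unfolding assms(5) using assms(1-4) by (simp add: minus_eq a_ac)
  finally show ?thesis using assms(1-4) by (simp add: r_neg)
qed

lemma (in abelian_group) diff_eq_zeroD:
  assumes "x \<ominus> y = \<zero>" "x \<in> carrier G" "y \<in> carrier G"
  shows "x = y"
  using assms minus_equality[of x "\<ominus> y"] by (simp add: minus_eq)

context left_module
begin

lemma smult_l_null [simp]: "x \<in> carrier M \<Longrightarrow> \<zero>\<^bsub>R\<^esub> \<odot>\<^bsub>M\<^esub> x = \<zero>\<^bsub>M\<^esub>"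
  using smult_l_distr[of "\<zero>\<^bsub>R\<^esub>" "\<zero>\<^bsub>R\<^esub>" x] by (simp add: M.add.r_cancel_one')

lemma smult_r_null [simp]: "a \<in> carrier R \<Longrightarrow> a \<odot>\<^bsub>M\<^esub> \<zero>\<^bsub>M\<^esub> = \<zero>\<^bsub>M\<^esub>"
  using smult_r_distr[of a "\<zero>\<^bsub>M\<^esub>" "\<zero>\<^bsub>M\<^esub>"] by (simp add: M.add.r_cancel_one')

lemma smult_minus_one: "x \<in> carrier M \<Longrightarrow> (\<ominus>\<^bsub>R\<^esub> \<one>\<^bsub>R\<^esub>) \<odot>\<^bsub>M\<^esub> x = \<ominus>\<^bsub>M\<^esub> x"
  using smult_l_distr[of "\<ominus>\<^bsub>R\<^esub> \<one>\<^bsub>R\<^esub>" "\<one>\<^bsub>R\<^esub>" x]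
  by (intro M.minus_equality[symmetric]) (simp_all add: R.l_neg)

lemma submoduleI:
  assumes "H \<subseteq> carrier M" "\<zero>\<^bsub>M\<^esub> \<in> H"
    and add: "\<And>x y. x \<in> H \<Longrightarrow> y \<in> H \<Longrightarrow> x \<oplus>\<^bsub>M\<^esub> y \<in> H"
    and smult: "\<And>a x. a \<in> carrier R \<Longrightarrow> x \<in> H \<Longrightarrow> a \<odot>\<^bsub>M\<^esub> x \<in> H"
  shows "submodule H R M"
proof -
  have "\<ominus>\<^bsub>M\<^esub> x \<in> H" if "x \<in> H" for x
    using smult[of "\<ominus>\<^bsub>R\<^esub> \<one>\<^bsub>R\<^esub>" x] smult_minus_one[of x] that assms(1) by auto
  then show ?thesis
    using assms by (intro submodule.intro subgroup.intro submodule_axioms.intro)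
      (simp_all add: a_inv_def)
qed

lemma submoduleD:
  assumes "submodule H R M"
  shows "H \<subseteq> carrier M" "\<zero>\<^bsub>M\<^esub> \<in> H"
    and "\<And>x. x \<in> H \<Longrightarrow> x \<in> carrier M"
    and "\<And>x y. x \<in> H \<Longrightarrow> y \<in> H \<Longrightarrow> x \<oplus>\<^bsub>M\<^esub> y \<in> H"
    and "\<And>x. x \<in> H \<Longrightarrow> \<ominus>\<^bsub>M\<^esub> x \<in> H"
    and "\<And>a x. a \<in> carrier R \<Longrightarrow> x \<in> H \<Longrightarrow> a \<odot>\<^bsub>M\<^esub> x \<in> H"
    and "\<And>x y. x \<in> H \<Longrightarrow> y \<in> H \<Longrightarrow> x \<ominus>\<^bsub>M\<^esub> y \<in> H"
proof -
  interpret submodule H R M by fact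
  show "H \<subseteq> carrier M" "\<zero>\<^bsub>M\<^esub> \<in> H" "\<And>x. x \<in> H \<Longrightarrow> x \<in> carrier M"
    "\<And>x y. x \<in> H \<Longrightarrow> y \<in> H \<Longrightarrow> x \<oplus>\<^bsub>M\<^esub> y \<in> H"
    "\<And>a x. a \<in> carrier R \<Longrightarrow> x \<in> H \<Longrightarrow> a \<odot>\<^bsub>M\<^esub> x \<in> H"
    and minus: "\<And>x. x \<in> H \<Longrightarrow> \<ominus>\<^bsub>M\<^esub> x \<in> H"
    using subset one_closed m_closed m_inv_closed by (auto simp: a_inv_def)
  then show "\<And>x y. x \<in> H \<Longrightarrow> y \<in> H \<Longrightarrow> x \<ominus>\<^bsub>M\<^esub> y \<in> H" by (simp add: M.minus_eq)
qed

lemma submodule_carrier: "submodule (carrier M) R M"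
  by (rule submoduleI) auto

lemma submodule_zero: "submodule {\<zero>\<^bsub>M\<^esub>} R M"
  by (rule submoduleI) auto

lemma submodule_set_add:
  assumes "submodule H R M" "submodule K R M" shows "submodule (H <+>\<^bsub>M\<^esub> K) R M"
proof (rule submoduleI)
  note H = submoduleD[OF assms(1)] and K = submoduleD[OF assms(2)]
  show "H <+>\<^bsub>M\<^esub> K \<subseteq> carrier M" using H(3) K(3) by (auto simp: set_add_def')
  have "\<zero>\<^bsub>M\<^esub> = \<zero>\<^bsub>M\<^esub> \<oplus>\<^bsub>M\<^esub> \<zero>\<^bsub>M\<^esub>" by simp
  then show "\<zero>\<^bsub>M\<^esub> \<in> H <+>\<^bsub>M\<^esub> K" using H(2) K(2) unfolding set_add_def' by blast
  fix x assume "x \<in> H <+>\<^bsub>M\<^esub> K"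
  then obtain h k where x: "x = h \<oplus>\<^bsub>M\<^esub> k" "h \<in> H" "k \<in> K" unfolding set_add_def' by blast
  show "x \<oplus>\<^bsub>M\<^esub> y \<in> H <+>\<^bsub>M\<^esub> K" if y: "y \<in> H <+>\<^bsub>M\<^esub> K" for y
  proof -
    obtain h' k' where y: "y = h' \<oplus>\<^bsub>M\<^esub> k'" "h' \<in> H" "k' \<in> K"
      using y unfolding set_add_def' by blast
    have "x \<oplus>\<^bsub>M\<^esub> y = (h \<oplus>\<^bsub>M\<^esub> h') \<oplus>\<^bsub>M\<^esub> (k \<oplus>\<^bsub>M\<^esub> k')" using x y H(3) K(3) by (simp add: M.a_ac)
    then show ?thesis using H(4)[OF x(2) y(2)] K(4)[OF x(3) y(3)] unfolding set_add_def' by blast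
  qed
  show "a \<odot>\<^bsub>M\<^esub> x \<in> H <+>\<^bsub>M\<^esub> K" if "a \<in> carrier R" for a
  proof -
    have "a \<odot>\<^bsub>M\<^esub> x = a \<odot>\<^bsub>M\<^esub> h \<oplus>\<^bsub>M\<^esub> a \<odot>\<^bsub>M\<^esub> k"
      using x that H(3) K(3) by (simp add: smult_r_distr)
    then show ?thesis using H(6)[OF that x(2)] K(6)[OF that x(3)] unfolding set_add_def' by blast
  qed
qed

lemma set_add_upper:
  assumes "submodule H R M" "submodule K R M"
  shows "H \<subseteq> H <+>\<^bsub>M\<^esub> K" "K \<subseteq> H <+>\<^bsub>M\<^esub> K"
proof -
  note H = submoduleD[OF assms(1)] and K = submoduleD[OF assms(2)]
  have "x = x \<oplus>\<^bsub>M\<^esub> \<zero>\<^bsub>M\<^esub>" if "x \<in> H" for x using that H(3) by simp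
  then show "H \<subseteq> H <+>\<^bsub>M\<^esub> K" using K(2) unfolding set_add_def' by blast
  have "x = \<zero>\<^bsub>M\<^esub> \<oplus>\<^bsub>M\<^esub> x" if "x \<in> K" for x using that K(3) by simp
  then show "K \<subseteq> H <+>\<^bsub>M\<^esub> K" using H(2) unfolding set_add_def' by blast
qed

lemma set_add_least:
  assumes "submodule L R M" "H \<subseteq> L" "K \<subseteq> L" shows "H <+>\<^bsub>M\<^esub> K \<subseteq> L"
  using assms(2,3) submoduleD(4)[OF assms(1)] by (auto simp: set_add_def')

lemma set_add_absorb:
  assumes "submodule H R M" "submodule K R M" "H \<subseteq> K" shows "H <+>\<^bsub>M\<^esub> K = K"
  using set_add_least[OF assms(2,3)] set_add_upper(2)[OF assms(1,2)] by blast

lemma set_add_absorb_left: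
  assumes "submodule H R M" "submodule K R M" "H \<subseteq> K" shows "K <+>\<^bsub>M\<^esub> H = K"
  using set_add_least[OF assms(2) subset_refl assms(3)] set_add_upper(1)[OF assms(2,1)] by blast

text \<open>In each equation both sides are the least submodule containing \<open>A\<close> and
  \<open>K\<close>. The first serves \<open>good_add_image\<close>, the second
  \<open>tower_good\<close>, where the fixed summand stands on the other side.\<close>

lemma set_add_assoc_absorb:
  assumes A: "submodule A R M" and H: "submodule H R M" and K: "submodule K R M" and "H \<subseteq> K"
  shows "(A <+>\<^bsub>M\<^esub> H) <+>\<^bsub>M\<^esub> K = A <+>\<^bsub>M\<^esub> K" "(H <+>\<^bsub>M\<^esub> A) <+>\<^bsub>M\<^esub> K = K <+>\<^bsub>M\<^esub> A"
proof -
  note AH = submodule_set_add[OF A H] and AK = submodule_set_add[OF A K]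
    and HA = submodule_set_add[OF H A] and KA = submodule_set_add[OF K A]
  note u = set_add_upper[OF A H] set_add_upper[OF A K] set_add_upper[OF H A] set_add_upper[OF K A]
    set_add_upper[OF AH K] set_add_upper[OF HA K]
  show "(A <+>\<^bsub>M\<^esub> H) <+>\<^bsub>M\<^esub> K = A <+>\<^bsub>M\<^esub> K"
  proof
    show "(A <+>\<^bsub>M\<^esub> H) <+>\<^bsub>M\<^esub> K \<subseteq> A <+>\<^bsub>M\<^esub> K"
      using u \<open>H \<subseteq> K\<close> by (intro set_add_least[OF AK]) auto
    show "A <+>\<^bsub>M\<^esub> K \<subseteq> (A <+>\<^bsub>M\<^esub> H) <+>\<^bsub>M\<^esub> K"
      using u by (intro set_add_least[OF submodule_set_add[OF AH K]]) auto
  qed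
  show "(H <+>\<^bsub>M\<^esub> A) <+>\<^bsub>M\<^esub> K = K <+>\<^bsub>M\<^esub> A"
  proof
    show "(H <+>\<^bsub>M\<^esub> A) <+>\<^bsub>M\<^esub> K \<subseteq> K <+>\<^bsub>M\<^esub> A"
      using u \<open>H \<subseteq> K\<close> by (intro set_add_least[OF KA]) auto
    show "K <+>\<^bsub>M\<^esub> A \<subseteq> (H <+>\<^bsub>M\<^esub> A) <+>\<^bsub>M\<^esub> K"
      using u by (intro set_add_least[OF submodule_set_add[OF HA K]]) auto
  qed
qed

lemma submodule_Union_chain:
  assumes sub: "\<And>D. D \<in> \<D> \<Longrightarrow> submodule D R M" and "\<D> \<noteq> {}"
    and chain: "\<And>D E. D \<in> \<D> \<Longrightarrow> E \<in> \<D> \<Longrightarrow> D \<subseteq> E \<or> E \<subseteq> D"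
  shows "submodule (\<Union>\<D>) R M"
proof (rule submoduleI)
  show "\<Union>\<D> \<subseteq> carrier M" using submoduleD(1)[OF sub] by blast
  show "\<zero>\<^bsub>M\<^esub> \<in> \<Union>\<D>" using \<open>\<D> \<noteq> {}\<close> submoduleD(2)[OF sub] by blast
  show "a \<odot>\<^bsub>M\<^esub> x \<in> \<Union>\<D>" if "a \<in> carrier R" "x \<in> \<Union>\<D>" for a x
    using that submoduleD(6)[OF sub] by blast
  fix x y assume "x \<in> \<Union>\<D>" "y \<in> \<Union>\<D>"
  then obtain D where "D \<in> \<D>" "x \<in> D" "y \<in> D" using chain by blast
  then show "x \<oplus>\<^bsub>M\<^esub> y \<in> \<Union>\<D>" using submoduleD(4)[OF sub] by blast
qed

end

section \<open>Homomorphisms and the factors of a filtration\<close>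

lemma lmod_homD:
  assumes "f \<in> lmod_hom R M N"
  shows "x \<in> carrier M \<Longrightarrow> f x \<in> carrier N"
    and "x \<in> carrier M \<Longrightarrow> y \<in> carrier M \<Longrightarrow> f (x \<oplus>\<^bsub>M\<^esub> y) = f x \<oplus>\<^bsub>N\<^esub> f y"
    and "a \<in> carrier R \<Longrightarrow> x \<in> carrier M \<Longrightarrow> f (a \<odot>\<^bsub>M\<^esub> x) = a \<odot>\<^bsub>N\<^esub> f x"
  using assms unfolding lmod_hom_def by auto

lemma lmod_homI:
  assumes "\<And>x. x \<in> carrier M \<Longrightarrow> f x \<in> carrier N"
    and "\<And>x y. x \<in> carrier M \<Longrightarrow> y \<in> carrier M \<Longrightarrow> f (x \<oplus>\<^bsub>M\<^esub> y) = f x \<oplus>\<^bsub>N\<^esub> f y"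
    and "\<And>a x. a \<in> carrier R \<Longrightarrow> x \<in> carrier M \<Longrightarrow> f (a \<odot>\<^bsub>M\<^esub> x) = a \<odot>\<^bsub>N\<^esub> f x"
  shows "f \<in> lmod_hom R M N"
  using assms unfolding lmod_hom_def by auto

lemma lmod_hom_comp:
  assumes "f \<in> lmod_hom R M N" "g \<in> lmod_hom R N L"
  shows "(\<lambda>x. g (f x)) \<in> lmod_hom R M L"
  by (rule lmod_homI) (simp_all add: lmod_homD[OF assms(1)] lmod_homD[OF assms(2)])

lemma lmod_hom_id: "(\<lambda>x. x) \<in> lmod_hom R M M"
  by (rule lmod_homI) simp_all

lemma lmod_hom_codomain:
  assumes "f \<in> lmod_hom R M (N\<lparr>carrier := W\<rparr>)" "W \<subseteq> carrier N"
  shows "f \<in> lmod_hom R M N"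
  by (rule lmod_homI) (use assms(2) lmod_homD[OF assms(1)] in auto)

text \<open>Zero and negatives are preserved because they are multiples by the scalars
  \<open>\<zero>\<close> and \<open>\<ominus> \<one>\<close>. All operations are those of
  \<open>M\<close>, so \<open>W\<close> is not treated as a module of its own here.\<close>

lemma lmod_hom_sub:
  assumes M: "left_module R M" and X: "left_module R X" and W: "submodule W R M"
    and h: "h \<in> lmod_hom R (M\<lparr>carrier := W\<rparr>) X"
  shows "h \<zero>\<^bsub>M\<^esub> = \<zero>\<^bsub>X\<^esub>"
    and "x \<in> W \<Longrightarrow> h (\<ominus>\<^bsub>M\<^esub> x) = \<ominus>\<^bsub>X\<^esub> h x"
    and "x \<in> W \<Longrightarrow> y \<in> W \<Longrightarrow> h (x \<ominus>\<^bsub>M\<^esub> y) = h x \<ominus>\<^bsub>X\<^esub> h y"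
    and "x \<in> W \<Longrightarrow> y \<in> W \<Longrightarrow> h (x \<oplus>\<^bsub>M\<^esub> y) = h x \<oplus>\<^bsub>X\<^esub> h y"
    and "a \<in> carrier R \<Longrightarrow> x \<in> W \<Longrightarrow> h (a \<odot>\<^bsub>M\<^esub> x) = a \<odot>\<^bsub>X\<^esub> h x"
    and "x \<in> W \<Longrightarrow> h x \<in> carrier X"
proof -
  interpret M: left_module R M by fact
  interpret X: left_module R X by fact
  note W = M.submoduleD[OF W] and h = lmod_homD[OF h, simplified]
  show add: "x \<in> W \<Longrightarrow> y \<in> W \<Longrightarrow> h (x \<oplus>\<^bsub>M\<^esub> y) = h x \<oplus>\<^bsub>X\<^esub> h y"
    and sm: "a \<in> carrier R \<Longrightarrow> x \<in> W \<Longrightarrow> h (a \<odot>\<^bsub>M\<^esub> x) = a \<odot>\<^bsub>X\<^esub> h x"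
    and cl: "x \<in> W \<Longrightarrow> h x \<in> carrier X" for a x y
    by (simp_all add: h)
  show "h \<zero>\<^bsub>M\<^esub> = \<zero>\<^bsub>X\<^esub>" using sm[of "\<zero>\<^bsub>R\<^esub>" "\<zero>\<^bsub>M\<^esub>"] cl[OF W(2)] W(2) by simp
  show minus: "x \<in> W \<Longrightarrow> h (\<ominus>\<^bsub>M\<^esub> x) = \<ominus>\<^bsub>X\<^esub> h x" for x
    using sm[of "\<ominus>\<^bsub>R\<^esub> \<one>\<^bsub>R\<^esub>" x] cl[of x] W(3)[of x] by (simp add: M.smult_minus_one X.smult_minus_one)
  show "x \<in> W \<Longrightarrow> y \<in> W \<Longrightarrow> h (x \<ominus>\<^bsub>M\<^esub> y) = h x \<ominus>\<^bsub>X\<^esub> h y"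
    using W(5) by (simp add: M.minus_eq X.minus_eq minus add)
qed

lemma lmod_hom_arith:
  assumes M: "left_module R M" and N: "left_module R N" and f: "f \<in> lmod_hom R M N"
  shows "f \<zero>\<^bsub>M\<^esub> = \<zero>\<^bsub>N\<^esub>"
    and "x \<in> carrier M \<Longrightarrow> f (\<ominus>\<^bsub>M\<^esub> x) = \<ominus>\<^bsub>N\<^esub> f x"
    and "x \<in> carrier M \<Longrightarrow> y \<in> carrier M \<Longrightarrow> f (x \<ominus>\<^bsub>M\<^esub> y) = f x \<ominus>\<^bsub>N\<^esub> f y"
proof -
  have "f \<in> lmod_hom R (M\<lparr>carrier := carrier M\<rparr>) N" using f by simp
  from lmod_hom_sub[OF M N left_module.submodule_carrier[OF M] this]
  show "f \<zero>\<^bsub>M\<^esub> = \<zero>\<^bsub>N\<^esub>"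
    and "x \<in> carrier M \<Longrightarrow> f (\<ominus>\<^bsub>M\<^esub> x) = \<ominus>\<^bsub>N\<^esub> f x"
    and "x \<in> carrier M \<Longrightarrow> y \<in> carrier M \<Longrightarrow> f (x \<ominus>\<^bsub>M\<^esub> y) = f x \<ominus>\<^bsub>N\<^esub> f y" by auto
qed

lemma submodule_hom_image:
  assumes M: "left_module R M" and N: "left_module R N" and f: "f \<in> lmod_hom R M N"
    and H: "submodule H R M"
  shows "submodule (f ` H) R N"
proof -
  interpret M: left_module R M by fact
  interpret N: left_module R N by fact
  note H = M.submoduleD[OF H] and f = lmod_homD[OF f] lmod_hom_arith[OF M N f]
  show ?thesis
  proof (rule N.submoduleI)
    show "f ` H \<subseteq> carrier N" using f(1) H(3) by blast
    show "\<zero>\<^bsub>N\<^esub> \<in> f ` H" using f(4) H(2) by (metis image_eqI)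
    show "x \<oplus>\<^bsub>N\<^esub> y \<in> f ` H" if "x \<in> f ` H" "y \<in> f ` H" for x y
      using that H(3,4) f(2)[symmetric] by auto
    show "a \<odot>\<^bsub>N\<^esub> x \<in> f ` H" if "a \<in> carrier R" "x \<in> f ` H" for a x
      using that H(3,6) f(3)[symmetric] by auto
  qed
qed

lemma submodule_hom_vimage:
  assumes M: "left_module R M" and N: "left_module R N" and f: "f \<in> lmod_hom R M N"
    and H: "submodule H R N"
  shows "submodule {x\<in>carrier M. f x \<in> H} R M"
proof -
  interpret M: left_module R M by fact
  interpret N: left_module R N by fact
  note H = N.submoduleD[OF H] and f = lmod_homD[OF f] lmod_hom_arith[OF M N f]
  show ?thesis by (rule M.submoduleI) (use H f in auto)
qed

text \<open>\<open>N\<close> may be any structure: the lemma is applied to \<open>lmod_sum\<close>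
  and \<open>lmod_quot\<close>, for which the module axioms are not established.\<close>

lemma lmod_hom_inv_into:
  assumes M: "left_module R M" and f: "f \<in> lmod_hom R M N" and bij: "bij_betw f (carrier M) (carrier N)"
  shows "inv_into (carrier M) f \<in> lmod_hom R N M"
proof -
  interpret M: left_module R M by fact
  let ?g = "inv_into (carrier M) f"
  have g: "?g x \<in> carrier M" "f (?g x) = x" if "x \<in> carrier N" for x
    using that bij by (auto simp: bij_betw_def inv_into_into f_inv_into_f)
  have eq: "?g x = y" if "y \<in> carrier M" "f y = x" for x y
    using that bij by (auto simp: bij_betw_def)
  show ?thesis
    by (rule lmod_homI) (use g in \<open>auto intro!: eq simp: lmod_homD[OF f]\<close>)
qed

text \<open>By the first isomorphism theorem, \<open>W/V\<close> is isomorphic to \<open>X\<close>.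
  An epimorphism with kernel \<open>V\<close> is easier to transport along homomorphisms than a
  module of cosets; \<open>factor_iff_lmod_isomorphic\<close> compares the two.\<close>

definition factor ::
  "('r, 's) ring_scheme \<Rightarrow> ('r, 'x) module set \<Rightarrow> ('r, 'm) module \<Rightarrow> 'm set \<Rightarrow> 'm set \<Rightarrow> bool"
  where "factor R \<X> M V W \<longleftrightarrow> submodule V R M \<and> submodule W R M \<and> V \<subseteq> W \<and>
    (\<exists>X\<in>\<X>. \<exists>h\<in>lmod_hom R (M\<lparr>carrier := W\<rparr>) X. h ` W = carrier X \<and>
      (\<forall>x\<in>W. h x = \<zero>\<^bsub>X\<^esub> \<longleftrightarrow> x \<in> V))"

lemma factorE:
  assumes "factor R \<X> M V W"
  obtains X h where "submodule V R M" "submodule W R M" "V \<subseteq> W" "X \<in> \<X>"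
    "h \<in> lmod_hom R (M\<lparr>carrier := W\<rparr>) X" "h ` W = carrier X"
    "\<And>x. x \<in> W \<Longrightarrow> h x = \<zero>\<^bsub>X\<^esub> \<longleftrightarrow> x \<in> V"
proof -
  from assms show ?thesis
    unfolding factor_def by (elim conjE bexE) (rule that, assumption+, erule (1) bspec)
qed

text \<open>\<open>q\<close> induces an isomorphism from \<open>W/V\<close> to the quotient of
  \<open>V' + q W\<close> by \<open>V'\<close>: it is onto by construction and injective by
  \<open>ker\<close>.\<close>

lemma factor_push:
  assumes M: "left_module R M" and N: "left_module R N" and \<X>: "\<And>X. X \<in> \<X> \<Longrightarrow> left_module R X"
    and q: "q \<in> lmod_hom R M N" and fac: "factor R \<X> M V W" and V': "submodule V' R N"
    and ker: "\<And>x. x \<in> W \<Longrightarrow> q x \<in> V' \<longleftrightarrow> x \<in> V"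
  shows "factor R \<X> N V' (V' <+>\<^bsub>N\<^esub> q ` W)"
proof -
  interpret M: left_module R M by fact
  interpret N: left_module R N by fact
  obtain X h where V: "submodule V R M" and W: "submodule W R M" and "V \<subseteq> W" "X \<in> \<X>"
    and h: "h \<in> lmod_hom R (M\<lparr>carrier := W\<rparr>) X" and surj: "h ` W = carrier X"
    and hV: "\<And>x. x \<in> W \<Longrightarrow> h x = \<zero>\<^bsub>X\<^esub> \<longleftrightarrow> x \<in> V"
    using factorE[OF fac] by metis
  have X: "left_module R X" using \<X> \<open>X \<in> \<X>\<close> .
  interpret X: left_module R X by fact
  note WD = M.submoduleD[OF W] and V'D = N.submoduleD[OF V'] and qD = lmod_homD[OF q] lmod_hom_arith[OF M N q]
    and hD = lmod_hom_sub[OF M X W h]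
  let ?W' = "V' <+>\<^bsub>N\<^esub> q ` W"
  have qW: "submodule (q ` W) R N" using submodule_hom_image[OF M N q W] .
  have W': "submodule ?W' R N" "V' \<subseteq> ?W'"
    using N.submodule_set_add[OF V' qW] N.set_add_upper[OF V' qW] by auto
  \<comment> \<open>An element of the sum is sent to the value of \<open>h\<close> at the
    \<open>W\<close>-part of a chosen decomposition. Two choices differ by an element of
    \<open>W\<close> that \<open>q\<close> maps into \<open>V'\<close>, hence by an element of
    \<open>V\<close>, where \<open>h\<close> vanishes.\<close>
  define h' where "h' y = h (SOME x. x \<in> W \<and> (\<exists>v\<in>V'. y = v \<oplus>\<^bsub>N\<^esub> q x))" for y
  have h': "h' (v \<oplus>\<^bsub>N\<^esub> q x) = h x" if "v \<in> V'" "x \<in> W" for v x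
  proof -
    let ?P = "\<lambda>x'. x' \<in> W \<and> (\<exists>v'\<in>V'. v \<oplus>\<^bsub>N\<^esub> q x = v' \<oplus>\<^bsub>N\<^esub> q x')"
    have "?P (SOME x'. ?P x')" by (rule someI[of ?P x]) (use that in auto)
    then obtain x' v' where x': "x' = (SOME x'. ?P x')" "x' \<in> W" "v' \<in> V'"
      and eq: "v \<oplus>\<^bsub>N\<^esub> q x = v' \<oplus>\<^bsub>N\<^esub> q x'" by blast
    have c: "v \<in> carrier N" "v' \<in> carrier N" "q x \<in> carrier N" "q x' \<in> carrier N"
      using that x' V'D(3) WD(3) qD(1) by auto
    have "q x \<ominus>\<^bsub>N\<^esub> q x' = v' \<ominus>\<^bsub>N\<^esub> v" using N.diff_eq_diff[OF c eq] .
    then have "q (x \<ominus>\<^bsub>M\<^esub> x') \<in> V'" using that x' WD(3) V'D(7) qD(6) by simp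
    then have "x \<ominus>\<^bsub>M\<^esub> x' \<in> V" using ker that x' WD(7) by blast
    then have "h x \<ominus>\<^bsub>X\<^esub> h x' = \<zero>\<^bsub>X\<^esub>" using hV hD(3) that x' WD(7) by metis
    then have "h x = h x'" using X.diff_eq_zeroD hD(6) that(2) x'(2) by blast
    then show ?thesis unfolding h'_def x'(1) by simp
  qed
  have rep: "\<exists>v x. v \<in> V' \<and> x \<in> W \<and> y = v \<oplus>\<^bsub>N\<^esub> q x" if "y \<in> ?W'" for y
    using that unfolding set_add_def' by blast
  have hom: "h' \<in> lmod_hom R (N\<lparr>carrier := ?W'\<rparr>) X"
  proof (rule lmod_homI; simp)
    fix y assume "y \<in> ?W'"
    then obtain v x where y: "v \<in> V'" "x \<in> W" "y = v \<oplus>\<^bsub>N\<^esub> q x" using rep by blast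
    note c = y V'D(3)[OF y(1)] WD(3)[OF y(2)] qD(1)[OF WD(3)[OF y(2)]]
    show "h' y \<in> carrier X" using y h' hD(6) by simp
    show "h' (y \<oplus>\<^bsub>N\<^esub> z) = h' y \<oplus>\<^bsub>X\<^esub> h' z" if zW: "z \<in> ?W'" for z
    proof -
      obtain u w where z: "u \<in> V'" "w \<in> W" "z = u \<oplus>\<^bsub>N\<^esub> q w" using rep[OF zW] by blast
      note c' = z V'D(3)[OF z(1)] WD(3)[OF z(2)] qD(1)[OF WD(3)[OF z(2)]]
      have "y \<oplus>\<^bsub>N\<^esub> z = (v \<oplus>\<^bsub>N\<^esub> u) \<oplus>\<^bsub>N\<^esub> q (x \<oplus>\<^bsub>M\<^esub> w)" using c c' by (simp add: qD(2) N.a_ac)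
      then have "h' (y \<oplus>\<^bsub>N\<^esub> z) = h (x \<oplus>\<^bsub>M\<^esub> w)" using c c' V'D(4) WD(4) h' by simp
      then show ?thesis using c c' h' hD(4) by simp
    qed
    show "h' (a \<odot>\<^bsub>N\<^esub> y) = a \<odot>\<^bsub>X\<^esub> h' y" if "a \<in> carrier R" for a
    proof -
      have "a \<odot>\<^bsub>N\<^esub> y = a \<odot>\<^bsub>N\<^esub> v \<oplus>\<^bsub>N\<^esub> q (a \<odot>\<^bsub>M\<^esub> x)" using c that by (simp add: qD(3) N.smult_r_distr)
      then show ?thesis using c that V'D(6) WD(6) h' hD(5) by simp
    qed
  qed
  have "h' y = \<zero>\<^bsub>X\<^esub> \<longleftrightarrow> y \<in> V'" if "y \<in> ?W'" for y
  proof -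
    obtain v x where y: "v \<in> V'" "x \<in> W" "y = v \<oplus>\<^bsub>N\<^esub> q x" using rep \<open>y \<in> ?W'\<close> by blast
    have c: "v \<in> carrier N" "q x \<in> carrier N" using y V'D(3) WD(3) qD(1) by auto
    have "q x = \<ominus>\<^bsub>N\<^esub> v \<oplus>\<^bsub>N\<^esub> y" using c y(3) by (simp add: N.r_neg1)
    then have "y \<in> V' \<longleftrightarrow> q x \<in> V'" using y V'D(4,5) by metis
    then show ?thesis using y h' hV ker by metis
  qed
  moreover have "h' ` ?W' = carrier X"
  proof
    show "h' ` ?W' \<subseteq> carrier X" using lmod_homD(1)[OF hom] by auto
    show "carrier X \<subseteq> h' ` ?W'"
    proof
      fix z assume "z \<in> carrier X"
      then obtain x where x: "x \<in> W" "z = h x" using surj by blast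
      then have "z = h' (\<zero>\<^bsub>N\<^esub> \<oplus>\<^bsub>N\<^esub> q x)" using h' V'D(2) by simp
      then show "z \<in> h' ` ?W'" using x V'D(2) unfolding set_add_def' by blast
    qed
  qed
  ultimately show ?thesis
    unfolding factor_def using V' W' hom \<open>X \<in> \<X>\<close> by blast
qed

text \<open>The map induced by \<open>q\<close> from the quotient of the two preimages to
  \<open>W/V\<close> is injective by construction. It is onto because \<open>surj\<close> puts
  \<open>W\<close> into the sum of \<open>V\<close> and the image of \<open>q\<close>.\<close>

lemma factor_pull:
  assumes M: "left_module R M" and N: "left_module R N" and \<X>: "\<And>X. X \<in> \<X> \<Longrightarrow> left_module R X"
    and q: "q \<in> lmod_hom R M N" and fac: "factor R \<X> N V W"
    and surj: "\<And>w. w \<in> W \<Longrightarrow> \<exists>x\<in>carrier M. \<exists>v\<in>V. w = v \<oplus>\<^bsub>N\<^esub> q x"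
  shows "factor R \<X> M {x\<in>carrier M. q x \<in> V} {x\<in>carrier M. q x \<in> W}"
proof -
  interpret M: left_module R M by fact
  interpret N: left_module R N by fact
  obtain X h where V: "submodule V R N" and W: "submodule W R N" and "V \<subseteq> W" "X \<in> \<X>"
    and h: "h \<in> lmod_hom R (N\<lparr>carrier := W\<rparr>) X" and onto: "h ` W = carrier X"
    and hV: "\<And>x. x \<in> W \<Longrightarrow> h x = \<zero>\<^bsub>X\<^esub> \<longleftrightarrow> x \<in> V"
    using factorE[OF fac] by metis
  have X: "left_module R X" using \<X> \<open>X \<in> \<X>\<close> .
  interpret X: left_module R X by fact
  note WD = N.submoduleD[OF W] and VD = N.submoduleD[OF V] and qD = lmod_homD[OF q]
    and hD = lmod_hom_sub[OF N X W h]
  let ?W' = "{x\<in>carrier M. q x \<in> W}"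
  have hom: "(\<lambda>x. h (q x)) \<in> lmod_hom R (M\<lparr>carrier := ?W'\<rparr>) X"
    by (rule lmod_homI) (use hD(4-6) qD in auto)
  moreover have "(\<lambda>x. h (q x)) ` ?W' = carrier X"
  proof
    show "(\<lambda>x. h (q x)) ` ?W' \<subseteq> carrier X" using hD(6) by auto
    show "carrier X \<subseteq> (\<lambda>x. h (q x)) ` ?W'"
    proof
      fix z assume "z \<in> carrier X"
      then obtain w where w: "w \<in> W" "z = h w" using onto by blast
      then obtain x v where x: "x \<in> carrier M" "v \<in> V" "w = v \<oplus>\<^bsub>N\<^esub> q x" using surj by blast
      have "v \<in> W" using x \<open>V \<subseteq> W\<close> by blast
      have "q x = \<ominus>\<^bsub>N\<^esub> v \<oplus>\<^bsub>N\<^esub> w" using x VD(3) qD(1) by (simp add: N.r_neg1)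
      then have qx: "q x \<in> W" using w(1) \<open>v \<in> W\<close> WD(4,5) by metis
      have "h v = \<zero>\<^bsub>X\<^esub>" using hV x(2) \<open>v \<in> W\<close> by blast
      then have "z = h (q x)" unfolding w(2) x(3) using hD(4)[OF \<open>v \<in> W\<close> qx] hD(6)[OF qx] by simp
      then show "z \<in> (\<lambda>x. h (q x)) ` ?W'" using x(1) qx by blast
    qed
  qed
  ultimately show ?thesis
    unfolding factor_def using \<open>X \<in> \<X>\<close> \<open>V \<subseteq> W\<close> hV
    by (intro conjI submodule_hom_vimage[OF M N q] V W bexI[of _ X] bexI[of _ "\<lambda>x. h (q x)"]) auto
qed

section \<open>Free modules\<close>

primrec lincomb :: "('r, 'm, 't) module_scheme \<Rightarrow> nat \<Rightarrow> (nat \<Rightarrow> 'r) \<Rightarrow> (nat \<Rightarrow> 'm) \<Rightarrow> 'm" where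
  "lincomb M 0 c y = \<zero>\<^bsub>M\<^esub>"
| "lincomb M (Suc k) c y = lincomb M k c y \<oplus>\<^bsub>M\<^esub> c k \<odot>\<^bsub>M\<^esub> y k"

lemma lincomb_cong:
  assumes "\<And>i. i < k \<Longrightarrow> c i = d i" "\<And>i. i < k \<Longrightarrow> y i = z i"
  shows "lincomb M k c y = lincomb M k d z"
  using assms by (induction k) auto

context left_module
begin

lemma lincomb_in_submodule:
  assumes "submodule H R M" "\<And>i. i < k \<Longrightarrow> c i \<in> carrier R" "\<And>i. i < k \<Longrightarrow> y i \<in> H"
  shows "lincomb M k c y \<in> H"
  using assms(2,3) by (induction k) (simp_all add: submoduleD[OF assms(1)])

lemma lincomb_closed:
  assumes "\<And>i. i < k \<Longrightarrow> c i \<in> carrier R" "\<And>i. i < k \<Longrightarrow> y i \<in> carrier M"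
  shows "lincomb M k c y \<in> carrier M"
  using lincomb_in_submodule[OF submodule_carrier assms] .

lemma lincomb_add:
  assumes "\<And>i. i < k \<Longrightarrow> c i \<in> carrier R" "\<And>i. i < k \<Longrightarrow> d i \<in> carrier R"
    and "\<And>i. i < k \<Longrightarrow> y i \<in> carrier M"
  shows "lincomb M k (\<lambda>i. c i \<oplus>\<^bsub>R\<^esub> d i) y = lincomb M k c y \<oplus>\<^bsub>M\<^esub> lincomb M k d y"
  using assms
proof (induction k)
  case (Suc k)
  then show ?case
    using lincomb_closed[of k c y] lincomb_closed[of k d y] by (simp add: smult_l_distr M.a_ac)
qed simp

lemma lincomb_smult:
  assumes "a \<in> carrier R" "\<And>i. i < k \<Longrightarrow> c i \<in> carrier R" "\<And>i. i < k \<Longrightarrow> y i \<in> carrier M"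
  shows "lincomb M k (\<lambda>i. a \<otimes>\<^bsub>R\<^esub> c i) y = a \<odot>\<^bsub>M\<^esub> lincomb M k c y"
  using assms
proof (induction k)
  case (Suc k)
  then show ?case
    using lincomb_closed[of k c y] by (simp add: smult_r_distr smult_assoc1)
qed simp

end

lemma lincomb_hom:
  assumes M: "left_module R M" and N: "left_module R N" and W: "submodule W R M" and h: "h \<in> lmod_hom R (M\<lparr>carrier := W\<rparr>) N"
    and "\<And>i. i < k \<Longrightarrow> c i \<in> carrier R" "\<And>i. i < k \<Longrightarrow> y i \<in> W"
  shows "h (lincomb M k c y) = lincomb N k c (\<lambda>i. h (y i))"
  using assms(5,6)
proof (induction k)
  case 0
  then show ?case using lmod_hom_sub(1)[OF M N W h] by simp
next
  case (Suc k)
  then show ?case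
    using left_module.lincomb_in_submodule[OF M W, of k c y] left_module.submoduleD(6)[OF M W]
    by (simp add: lmod_hom_sub(4,5)[OF M N W h])
qed

lemma free_lmod_simps [simp]:
  "carrier (free_lmod R n) = {..<n} \<rightarrow>\<^sub>E carrier R"
  "\<zero>\<^bsub>free_lmod R n\<^esub> = (\<lambda>i\<in>{..<n}. \<zero>\<^bsub>R\<^esub>)"
  "x \<oplus>\<^bsub>free_lmod R n\<^esub> y = (\<lambda>i\<in>{..<n}. x i \<oplus>\<^bsub>R\<^esub> y i)"
  "a \<odot>\<^bsub>free_lmod R n\<^esub> x = (\<lambda>i\<in>{..<n}. a \<otimes>\<^bsub>R\<^esub> x i)"
  by (simp_all add: free_lmod_def)

lemma left_module_free:
  assumes "ring R" shows "left_module R (free_lmod R n)"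
proof -
  interpret ring R by fact
  have ab: "abelian_group (free_lmod R n)"
  proof (rule abelian_groupI)
    fix x assume x: "x \<in> carrier (free_lmod R n)"
    have "(\<lambda>i\<in>{..<n}. \<ominus>\<^bsub>R\<^esub> x i) \<in> carrier (free_lmod R n)" using x by auto
    moreover have "(\<lambda>i\<in>{..<n}. \<ominus>\<^bsub>R\<^esub> x i) \<oplus>\<^bsub>free_lmod R n\<^esub> x = \<zero>\<^bsub>free_lmod R n\<^esub>"
      using x by (auto simp: PiE_iff l_neg intro!: restrict_ext)
    ultimately show "\<exists>y\<in>carrier (free_lmod R n). y \<oplus>\<^bsub>free_lmod R n\<^esub> x = \<zero>\<^bsub>free_lmod R n\<^esub>"
      by blast
    show "\<zero>\<^bsub>free_lmod R n\<^esub> \<oplus>\<^bsub>free_lmod R n\<^esub> x = x"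
      using x by (intro extensionalityI[of _ "{..<n}"]) (auto simp: PiE_iff)
  qed (auto simp: PiE_iff a_ac intro!: restrict_ext)
  show ?thesis
  proof (intro left_module.intro assms ab left_module_axioms.intro)
    fix x assume x: "x \<in> carrier (free_lmod R n)"
    show "\<one>\<^bsub>R\<^esub> \<odot>\<^bsub>free_lmod R n\<^esub> x = x"
      using x by (intro extensionalityI[of _ "{..<n}"]) (auto simp: PiE_iff)
  qed (auto simp: PiE_iff l_distr r_distr m_assoc intro!: restrict_ext)
qed

text \<open>For \<open>i \<ge> n\<close> this is the zero vector, so \<open>unit_vec_closed\<close>
  holds for every index and later arguments may range over all of them.\<close>

definition unit_vec :: "('r, 's) ring_scheme \<Rightarrow> nat \<Rightarrow> nat \<Rightarrow> nat \<Rightarrow> 'r"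
  where "unit_vec R n i = (\<lambda>j\<in>{..<n}. if j = i then \<one>\<^bsub>R\<^esub> else \<zero>\<^bsub>R\<^esub>)"

lemma unit_vec_closed: "ring R \<Longrightarrow> unit_vec R n i \<in> carrier (free_lmod R n)"
  by (auto simp: unit_vec_def ring.ring_simprules)

lemma free_hom_eq_lincomb:
  assumes R: "ring R" and M: "left_module R M" and \<phi>: "\<phi> \<in> lmod_hom R (free_lmod R n) M"
    and c: "c \<in> carrier (free_lmod R n)"
  shows "\<phi> c = lincomb M n c (\<lambda>i. \<phi> (unit_vec R n i))"
proof -
  interpret R: ring R by fact
  interpret M: left_module R M by fact
  let ?P = "carrier (free_lmod R n)"
  \<comment> \<open>\<open>t k\<close> keeps the first \<open>k\<close> coordinates of
    \<open>c\<close>: it starts at zero, gains one multiple of a unit vector per step and reaches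
    \<open>c\<close> at \<open>k = n\<close>.\<close>
  define t where "t k = (\<lambda>i\<in>{..<n}. if i < k then c i else \<zero>\<^bsub>R\<^esub>)" for k
  have cR: "c i \<in> carrier R" if "i < n" for i using c that by auto
  have t: "t k \<in> ?P" for k using cR by (auto simp: t_def)
  have "\<phi> (t k) = lincomb M k c (\<lambda>i. \<phi> (unit_vec R n i))" if "k \<le> n" for k
    using that
  proof (induction k)
    case 0
    have "t 0 = \<zero>\<^bsub>free_lmod R n\<^esub>" by (simp add: t_def)
    then show ?case using lmod_hom_arith(1)[OF left_module_free[OF R] M \<phi>] by (metis lincomb.simps(1))
  next
    case (Suc k)
    have "t (Suc k) = t k \<oplus>\<^bsub>free_lmod R n\<^esub> c k \<odot>\<^bsub>free_lmod R n\<^esub> unit_vec R n k"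
      using cR Suc.prems by (auto simp: t_def unit_vec_def less_Suc_eq intro!: restrict_ext)
    moreover have "c k \<odot>\<^bsub>free_lmod R n\<^esub> unit_vec R n k \<in> ?P"
      using left_module.smult_closed[OF left_module_free[OF R] cR unit_vec_closed[OF R]] Suc.prems
      by simp
    ultimately have "\<phi> (t (Suc k)) = \<phi> (t k) \<oplus>\<^bsub>M\<^esub> \<phi> (c k \<odot>\<^bsub>free_lmod R n\<^esub> unit_vec R n k)"
      using lmod_homD(2)[OF \<phi>] t by metis
    then show ?case
      using Suc lmod_homD(3)[OF \<phi> cR unit_vec_closed[OF R]] by simp
  qed
  moreover have "t n = c"
    using c by (intro extensionalityI[of _ "{..<n}"]) (auto simp: t_def PiE_iff)
  ultimately show ?thesis by auto
qed

lemma lincomb_free_hom: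
  assumes R: "ring R" and M: "left_module R M" and y: "\<And>i. i < n \<Longrightarrow> y i \<in> carrier M"
  shows "(\<lambda>c. lincomb M n c y) \<in> lmod_hom R (free_lmod R n) M"
proof -
  interpret M: left_module R M by fact
  show ?thesis
  proof (rule lmod_homI)
    fix c assume c: "c \<in> carrier (free_lmod R n)"
    show "lincomb M n c y \<in> carrier M" using c y by (intro M.lincomb_closed) auto
    show "lincomb M n (a \<odot>\<^bsub>free_lmod R n\<^esub> c) y = a \<odot>\<^bsub>M\<^esub> lincomb M n c y"
      if "a \<in> carrier R" for a
      using M.lincomb_smult[OF that, of n c y] c y
      by (subst lincomb_cong[of n _ "\<lambda>i. a \<otimes>\<^bsub>R\<^esub> c i" _ y]) auto
    show "lincomb M n (c \<oplus>\<^bsub>free_lmod R n\<^esub> d) y = lincomb M n c y \<oplus>\<^bsub>M\<^esub> lincomb M n d y"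
      if "d \<in> carrier (free_lmod R n)" for d
      using M.lincomb_add[of n c d y] c that y
      by (subst lincomb_cong[of n _ "\<lambda>i. c i \<oplus>\<^bsub>R\<^esub> d i" _ y]) auto
  qed
qed

text \<open>Free modules are projective: the images of the basis are lifted along \<open>h\<close>,
  and these lifts determine \<open>\<phi>\<close>.\<close>

lemma free_hom_lift:
  assumes M: "left_module R M" and X: "left_module R X" and W: "submodule W R M"
    and h: "h \<in> lmod_hom R (M\<lparr>carrier := W\<rparr>) X" and surj: "h ` W = carrier X"
    and g: "g \<in> lmod_hom R (free_lmod R n) X"
  obtains \<phi> where "\<phi> \<in> lmod_hom R (free_lmod R n) M"
    "\<And>c. c \<in> carrier (free_lmod R n) \<Longrightarrow> \<phi> c \<in> W"
    "\<And>c. c \<in> carrier (free_lmod R n) \<Longrightarrow> h (\<phi> c) = g c"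
proof -
  interpret M: left_module R M by fact
  have R: "ring R" by (rule M.R.ring_axioms)
  have "\<exists>y\<in>W. h y = g (unit_vec R n i)" for i
    using lmod_homD(1)[OF g unit_vec_closed[OF R]] surj by (metis imageE)
  then obtain y where y: "\<And>i. y i \<in> W" "\<And>i. h (y i) = g (unit_vec R n i)" by metis
  show ?thesis
  proof (rule that)
    show "(\<lambda>c. lincomb M n c y) \<in> lmod_hom R (free_lmod R n) M"
      using y M.submoduleD(3)[OF W] by (intro lincomb_free_hom R M) auto
    fix c assume c: "c \<in> carrier (free_lmod R n)"
    show "lincomb M n c y \<in> W" using c y by (intro M.lincomb_in_submodule[OF W]) auto
    show "h (lincomb M n c y) = g c"
      using lincomb_hom[OF M X W h, of n c y] free_hom_eq_lincomb[OF R X g c] c y by auto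
  qed
qed

text \<open>The image is generated by the images of \<open>n\<close> basis vectors. Each lies in
  some member of the chain, and the largest of these finitely many members contains them
  all.\<close>

lemma free_hom_into_chain_Union:
  assumes M: "left_module R M" and \<phi>: "\<phi> \<in> lmod_hom R (free_lmod R n) M"
    and sub: "\<And>D. D \<in> \<D> \<Longrightarrow> submodule D R M" and "\<D> \<noteq> {}"
    and chain: "\<And>D E. D \<in> \<D> \<Longrightarrow> E \<in> \<D> \<Longrightarrow> D \<subseteq> E \<or> E \<subseteq> D"
    and im: "\<phi> ` carrier (free_lmod R n) \<subseteq> \<Union>\<D>"
  obtains D where "D \<in> \<D>" "\<phi> ` carrier (free_lmod R n) \<subseteq> D"
proof -
  interpret M: left_module R M by fact
  have R: "ring R" by (rule M.R.ring_axioms)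
  have "\<exists>D\<in>\<D>. \<forall>i<k. \<phi> (unit_vec R n i) \<in> D" for k
  proof (induction k)
    case 0
    then show ?case using \<open>\<D> \<noteq> {}\<close> by auto
  next
    case (Suc k)
    then obtain D where D: "D \<in> \<D>" "\<forall>i<k. \<phi> (unit_vec R n i) \<in> D" by blast
    obtain E where E: "E \<in> \<D>" "\<phi> (unit_vec R n k) \<in> E"
      using im unit_vec_closed[OF R] by blast
    show ?case
      using chain[OF D(1) E(1)] D E by (auto simp: less_Suc_eq)
  qed
  then obtain D where D: "D \<in> \<D>" "\<And>i. i < n \<Longrightarrow> \<phi> (unit_vec R n i) \<in> D" by blast
  have "\<phi> c \<in> D" if "c \<in> carrier (free_lmod R n)" for c
    using free_hom_eq_lincomb[OF R M \<phi> that] that D(2)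
      M.lincomb_in_submodule[OF sub[OF D(1)], of n c "\<lambda>i. \<phi> (unit_vec R n i)"] by auto
  then show ?thesis using that D(1) by blast
qed

section \<open>Good quotients\<close>

text \<open>The generators of a presentation are fixed, while the relations stay existential:
  goodness refers only to \<open>n\<close> and \<open>g\<close>, and the relations enter only in
  \<open>good_chain_Union\<close>.\<close>

definition presents :: "('r, 's) ring_scheme \<Rightarrow> ('r, 'x) module \<Rightarrow> nat \<Rightarrow> ((nat \<Rightarrow> 'r) \<Rightarrow> 'x) \<Rightarrow> bool"
  where "presents R X n g \<longleftrightarrow> g \<in> lmod_hom R (free_lmod R n) X \<and>
    g ` carrier (free_lmod R n) = carrier X \<and>
    (\<exists>m. \<exists>f\<in>lmod_hom R (free_lmod R m) (free_lmod R n).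
      f ` carrier (free_lmod R m) = a_kernel (free_lmod R n) X g)"

lemma finitely_presented_presents: "finitely_presented R X \<Longrightarrow> \<exists>n g. presents R X n g"
  unfolding finitely_presented_def presents_def by metis

text \<open>\<open>good R \<X> N U\<close> says that \<open>N/U\<close> is good, where a module is good if every nonzero
  homomorphism from a member of \<open>\<X>\<close> to it is injective with good cokernel. A homomorphism
  \<open>X \<rightarrow> N/U\<close> is represented by a homomorphism \<open>\<phi>\<close> to \<open>N\<close> from the free module in a presentation
  \<open>g\<close> of \<open>X\<close>, mapping the kernel of \<open>g\<close> to \<open>U\<close>.\<close>

coinductive good :: "('r, 's) ring_scheme \<Rightarrow> ('r, 'x) module set \<Rightarrow> ('r, 'm) module \<Rightarrow> 'm set \<Rightarrow> bool"
  for R \<X> N where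
  goodI: "submodule U R N \<Longrightarrow>
    (\<forall>X\<in>\<X>. \<forall>n g \<phi>. presents R X n g \<longrightarrow> \<phi> \<in> lmod_hom R (free_lmod R n) N \<longrightarrow>
      (\<forall>c\<in>carrier (free_lmod R n). g c = \<zero>\<^bsub>X\<^esub> \<longrightarrow> \<phi> c \<in> U) \<longrightarrow>
      \<phi> ` carrier (free_lmod R n) \<subseteq> U \<or>
      (\<forall>c\<in>carrier (free_lmod R n). \<phi> c \<in> U \<longrightarrow> g c = \<zero>\<^bsub>X\<^esub>) \<and>
      good R \<X> N (U <+>\<^bsub>N\<^esub> \<phi> ` carrier (free_lmod R n))) \<Longrightarrow>
    good R \<X> N U"

lemma good_submodule: "good R \<X> N U \<Longrightarrow> submodule U R N"
  by (erule good.cases) simp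

lemma goodD:
  assumes "good R \<X> N U" "X \<in> \<X>" "presents R X n g" "\<phi> \<in> lmod_hom R (free_lmod R n) N"
    and "\<And>c. c \<in> carrier (free_lmod R n) \<Longrightarrow> g c = \<zero>\<^bsub>X\<^esub> \<Longrightarrow> \<phi> c \<in> U"
    and "\<not> \<phi> ` carrier (free_lmod R n) \<subseteq> U"
  shows "\<And>c. c \<in> carrier (free_lmod R n) \<Longrightarrow> \<phi> c \<in> U \<Longrightarrow> g c = \<zero>\<^bsub>X\<^esub>"
    and "good R \<X> N (U <+>\<^bsub>N\<^esub> \<phi> ` carrier (free_lmod R n))"
proof -
  from assms(1) have "\<forall>X\<in>\<X>. \<forall>n g \<phi>. presents R X n g \<longrightarrow> \<phi> \<in> lmod_hom R (free_lmod R n) N \<longrightarrow>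
      (\<forall>c\<in>carrier (free_lmod R n). g c = \<zero>\<^bsub>X\<^esub> \<longrightarrow> \<phi> c \<in> U) \<longrightarrow>
      \<phi> ` carrier (free_lmod R n) \<subseteq> U \<or>
      (\<forall>c\<in>carrier (free_lmod R n). \<phi> c \<in> U \<longrightarrow> g c = \<zero>\<^bsub>X\<^esub>) \<and>
      good R \<X> N (U <+>\<^bsub>N\<^esub> \<phi> ` carrier (free_lmod R n))"
    by (rule good.cases) simp
  from this[rule_format, OF assms(2-5)] assms(6)
  show "\<And>c. c \<in> carrier (free_lmod R n) \<Longrightarrow> \<phi> c \<in> U \<Longrightarrow> g c = \<zero>\<^bsub>X\<^esub>"
    and "good R \<X> N (U <+>\<^bsub>N\<^esub> \<phi> ` carrier (free_lmod R n))" by blast+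
qed

text \<open>Coinduction with the harmless case removed: a zero map from \<open>X\<close> to
  \<open>N/U\<close> satisfies the definition anyway, so \<open>P\<close> is checked on nonzero maps
  only.\<close>

lemma good_coinduct_rule:
  assumes "P U" and "\<And>U. P U \<Longrightarrow> submodule U R N"
    and step: "\<And>U X n g \<phi>. P U \<Longrightarrow> X \<in> \<X> \<Longrightarrow> presents R X n g \<Longrightarrow>
      \<phi> \<in> lmod_hom R (free_lmod R n) N \<Longrightarrow>
      (\<And>c. c \<in> carrier (free_lmod R n) \<Longrightarrow> g c = \<zero>\<^bsub>X\<^esub> \<Longrightarrow> \<phi> c \<in> U) \<Longrightarrow>
      \<not> \<phi> ` carrier (free_lmod R n) \<subseteq> U \<Longrightarrow>
      (\<forall>c\<in>carrier (free_lmod R n). \<phi> c \<in> U \<longrightarrow> g c = \<zero>\<^bsub>X\<^esub>) \<and>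
      P (U <+>\<^bsub>N\<^esub> \<phi> ` carrier (free_lmod R n))"
  shows "good R \<X> N U"
  using \<open>P U\<close>
proof (coinduction arbitrary: U rule: good.coinduct)
  case (good U)
  have "\<phi> ` carrier (free_lmod R n) \<subseteq> U \<or>
      (\<forall>c\<in>carrier (free_lmod R n). \<phi> c \<in> U \<longrightarrow> g c = \<zero>\<^bsub>X\<^esub>) \<and>
      (P (U <+>\<^bsub>N\<^esub> \<phi> ` carrier (free_lmod R n)) \<or>
       good R \<X> N (U <+>\<^bsub>N\<^esub> \<phi> ` carrier (free_lmod R n)))"
    if "X \<in> \<X>" "presents R X n g" "\<phi> \<in> lmod_hom R (free_lmod R n) N"
      and ker: "\<forall>c\<in>carrier (free_lmod R n). g c = \<zero>\<^bsub>X\<^esub> \<longrightarrow> \<phi> c \<in> U" for X n g \<phi>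
  proof (cases "\<phi> ` carrier (free_lmod R n) \<subseteq> U")
    case False
    show ?thesis using step[OF good that(1-3) _ False] ker by simp
  qed simp
  then show ?case using assms(2)[OF good] by (intro exI[of _ U] conjI refl ballI allI impI) simp_all
qed

lemma free_image_submodule:
  assumes N: "left_module R N" and "\<phi> \<in> lmod_hom R (free_lmod R n) N"
  shows "submodule (\<phi> ` carrier (free_lmod R n)) R N"
proof -
  interpret N: left_module R N by fact
  have P: "left_module R (free_lmod R n)" by (rule left_module_free) (rule N.R.ring_axioms)
  show ?thesis
    by (rule submodule_hom_image[OF P N assms(2) left_module.submodule_carrier[OF P]])
qed

text \<open>This is where finite presentation enters: a map from \<open>X\<close> to the quotient by a directed
  union already exists at some stage of the union.\<close>

lemma good_chain_Union:
  assumes N: "left_module R N" and \<U>: "\<And>U. U \<in> \<U> \<Longrightarrow> good R \<X> N U" "\<U> \<noteq> {}"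
    "\<And>U V. U \<in> \<U> \<Longrightarrow> V \<in> \<U> \<Longrightarrow> U \<subseteq> V \<or> V \<subseteq> U"
  shows "good R \<X> N (\<Union>\<U>)"
proof -
  interpret N: left_module R N by fact
  \<comment> \<open>The coinduction runs over all unions of nonempty chains of good submodules:
    adding the image of a brick to such a union has to give another one.\<close>
  define P where "P U \<longleftrightarrow> (\<exists>\<U>. U = \<Union>\<U> \<and> \<U> \<noteq> {} \<and> (\<forall>U\<in>\<U>. good R \<X> N U) \<and>
    (\<forall>U\<in>\<U>. \<forall>V\<in>\<U>. U \<subseteq> V \<or> V \<subseteq> U))" for U
  show ?thesis
  proof (rule good_coinduct_rule[where P = P])
    show "P (\<Union>\<U>)" unfolding P_def using \<U> by blast
    show "submodule U R N" if "P U" for U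
    proof -
      obtain \<U> where "U = \<Union>\<U>" "\<U> \<noteq> {}" "\<forall>U\<in>\<U>. good R \<X> N U"
        "\<forall>U\<in>\<U>. \<forall>V\<in>\<U>. U \<subseteq> V \<or> V \<subseteq> U" using \<open>P U\<close> unfolding P_def by blast
      then show ?thesis using N.submodule_Union_chain[of \<U>] good_submodule by metis
    qed
    fix U X n g \<phi>
    assume "P U" and X: "X \<in> \<X>" "presents R X n g" and \<phi>: "\<phi> \<in> lmod_hom R (free_lmod R n) N"
      and ker: "\<And>c. c \<in> carrier (free_lmod R n) \<Longrightarrow> g c = \<zero>\<^bsub>X\<^esub> \<Longrightarrow> \<phi> c \<in> U"
      and nz: "\<not> \<phi> ` carrier (free_lmod R n) \<subseteq> U"
    let ?F = "carrier (free_lmod R n)"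
    from \<open>P U\<close> obtain \<U> where U: "U = \<Union>\<U>" "\<U> \<noteq> {}" and all_good: "\<forall>U\<in>\<U>. good R \<X> N U"
      and all_chain: "\<forall>U\<in>\<U>. \<forall>V\<in>\<U>. U \<subseteq> V \<or> V \<subseteq> U" unfolding P_def by blast
    note good = bspec[OF all_good] and chain = bspec[OF bspec[OF all_chain]]
    obtain m f where f: "f \<in> lmod_hom R (free_lmod R m) (free_lmod R n)"
      and im: "f ` carrier (free_lmod R m) = a_kernel (free_lmod R n) X g"
      using X(2) unfolding presents_def by blast
    have K: "f ` carrier (free_lmod R m) = {c\<in>?F. g c = \<zero>\<^bsub>X\<^esub>}"
      unfolding im a_kernel_def' by simp
    \<comment> \<open>The kernel of \<open>g\<close> is the image of \<open>f\<close>, hence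
      finitely generated, so \<open>\<phi>\<close> maps all of it into a single member
      \<open>V\<close> of the chain.\<close>
    have "(\<lambda>c. \<phi> (f c)) ` carrier (free_lmod R m) \<subseteq> \<Union>\<U>" using K ker U(1) by blast
    from free_hom_into_chain_Union[OF N lmod_hom_comp[OF f \<phi>] good_submodule[OF good] U(2) chain this]
    obtain V where V: "V \<in> \<U>" "(\<lambda>c. \<phi> (f c)) ` carrier (free_lmod R m) \<subseteq> V" by metis
    have kerV: "\<phi> c \<in> W" if c: "c \<in> ?F" "g c = \<zero>\<^bsub>X\<^esub>" and "V \<subseteq> W" for c W
    proof -
      obtain d where "d \<in> carrier (free_lmod R m)" "c = f d" using K c by blast
      then show ?thesis using V(2) \<open>V \<subseteq> W\<close> by blast
    qed
    have nzW: "\<not> \<phi> ` ?F \<subseteq> W" if "W \<in> \<U>" for W using nz U(1) that by blast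
    show "(\<forall>c\<in>?F. \<phi> c \<in> U \<longrightarrow> g c = \<zero>\<^bsub>X\<^esub>) \<and> P (U <+>\<^bsub>N\<^esub> \<phi> ` ?F)"
    proof (intro conjI ballI impI)
      fix c assume c: "c \<in> ?F" "\<phi> c \<in> U"
      then obtain W where W: "W \<in> \<U>" "V \<subseteq> W" "\<phi> c \<in> W" using U(1) chain V(1) by blast
      show "g c = \<zero>\<^bsub>X\<^esub>"
        by (rule goodD(1)[OF good[OF W(1)] X \<phi> kerV nzW[OF W(1)] c(1) W(3)]) (use W(2) in auto)
    next
      \<comment> \<open>For the members \<open>W\<close> above \<open>V\<close>,
        \<open>\<phi>\<close> represents a map from \<open>X\<close> to \<open>N/W\<close>, so
        goodness of \<open>N/W\<close> applies. Their sums with the image of \<open>\<phi>\<close>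
        again form a chain of good submodules, with the sum for \<open>U\<close> as its
        union.\<close>
      let ?\<V> = "(\<lambda>W. W <+>\<^bsub>N\<^esub> \<phi> ` ?F) ` {W\<in>\<U>. V \<subseteq> W}"
      have mono: "W <+>\<^bsub>N\<^esub> \<phi> ` ?F \<subseteq> W' <+>\<^bsub>N\<^esub> \<phi> ` ?F" if "W \<subseteq> W'" for W W'
        using that unfolding set_add_def' by blast
      have "U = \<Union>{W\<in>\<U>. V \<subseteq> W}" using U(1) chain V(1) by blast
      then have "U <+>\<^bsub>N\<^esub> \<phi> ` ?F = \<Union>?\<V>" unfolding set_add_def' by blast
      moreover have "good R \<X> N (W <+>\<^bsub>N\<^esub> \<phi> ` ?F)" if "W \<in> \<U>" "V \<subseteq> W" for W
        by (rule goodD(2)[OF good[OF that(1)] X \<phi> kerV nzW[OF that(1)]]) (use that(2) in auto)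
      moreover have "A \<subseteq> B \<or> B \<subseteq> A" if AB: "A \<in> ?\<V>" "B \<in> ?\<V>" for A B
      proof -
        obtain W W' where "A = W <+>\<^bsub>N\<^esub> \<phi> ` ?F" "B = W' <+>\<^bsub>N\<^esub> \<phi> ` ?F" "W \<in> \<U>" "W' \<in> \<U>"
          using AB by blast
        then show ?thesis using chain[of W W'] mono by metis
      qed
      ultimately show "P (U <+>\<^bsub>N\<^esub> \<phi> ` ?F)"
        unfolding P_def using V(1) by (intro exI[of _ ?\<V>]) auto
    qed
  qed
qed

text \<open>The map from \<open>W/V\<close> to \<open>N/U\<close> induced by \<open>f\<close> is a
  nonzero map from a brick, so goodness makes it injective with good cokernel. The work lies in
  representing it by a homomorphism from a free module, as \<open>good\<close> requires.\<close>

lemma good_step: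
  assumes M: "left_module R M" and N: "left_module R N" and \<X>: "\<And>X. X \<in> \<X> \<Longrightarrow> brick R X"
    and f: "f \<in> lmod_hom R M N" and fac: "factor R \<X> M V W"
    and good: "good R \<X> N U" and fV: "f ` V \<subseteq> U" and nz: "\<not> f ` W \<subseteq> U"
  shows "\<And>x. x \<in> W \<Longrightarrow> f x \<in> U \<Longrightarrow> x \<in> V" and "good R \<X> N (U <+>\<^bsub>N\<^esub> f ` W)"
proof -
  interpret M: left_module R M by fact
  interpret N: left_module R N by fact
  obtain X h where V: "submodule V R M" and W: "submodule W R M" and "V \<subseteq> W" "X \<in> \<X>"
    and h: "h \<in> lmod_hom R (M\<lparr>carrier := W\<rparr>) X" and surj: "h ` W = carrier X"
    and hV: "\<And>x. x \<in> W \<Longrightarrow> h x = \<zero>\<^bsub>X\<^esub> \<longleftrightarrow> x \<in> V"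
    using factorE[OF fac] by metis
  have X: "left_module R X" using \<X>[OF \<open>X \<in> \<X>\<close>] unfolding brick_def by blast
  interpret X: left_module R X by fact
  obtain n g where g: "presents R X n g"
    using \<X>[OF \<open>X \<in> \<X>\<close>] finitely_presented_presents unfolding brick_def by blast
  then have ghom: "g \<in> lmod_hom R (free_lmod R n) X" and gsurj: "g ` carrier (free_lmod R n) = carrier X"
    unfolding presents_def by auto
  let ?F = "carrier (free_lmod R n)"
  \<comment> \<open>The presentation \<open>g\<close> of the brick is lifted to \<open>W\<close>. As
    \<open>h\<close> has kernel \<open>V\<close>, this makes \<open>W\<close> the sum of
    \<open>V\<close> and the image of \<open>\<phi>\<close>; since \<open>f\<close> maps
    \<open>V\<close> into \<open>U\<close>, that image can replace \<open>W\<close>.\<close>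
  obtain \<phi> where \<phi>: "\<phi> \<in> lmod_hom R (free_lmod R n) M" "\<And>c. c \<in> ?F \<Longrightarrow> \<phi> c \<in> W"
    "\<And>c. c \<in> ?F \<Longrightarrow> h (\<phi> c) = g c"
    using free_hom_lift[OF M X W h surj ghom] by metis
  note f\<phi> = lmod_hom_comp[OF \<phi>(1) f]
  note WD = M.submoduleD[OF W] and VD = M.submoduleD[OF V]
    and hD = lmod_hom_sub[OF M X W h] and fD = lmod_homD[OF f] lmod_hom_arith[OF M N f]
  note U = good_submodule[OF good]
  note UD = N.submoduleD[OF U]
  have split: "\<exists>c\<in>?F. \<exists>v\<in>V. x = v \<oplus>\<^bsub>M\<^esub> \<phi> c" if x: "x \<in> W" for x
  proof -
    have "h x \<in> carrier X" using hD(6) x by blast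
    then obtain c where c: "c \<in> ?F" "g c = h x" using gsurj by (metis imageE)
    have "h (x \<ominus>\<^bsub>M\<^esub> \<phi> c) = \<zero>\<^bsub>X\<^esub>"
      using hD(3)[OF x \<phi>(2)[OF c(1)]] \<phi>(3)[OF c(1)] c(2) hD(6)[OF x]
      by (simp add: X.minus_eq X.r_neg)
    then have "x \<ominus>\<^bsub>M\<^esub> \<phi> c \<in> V" using hV WD(7) x \<phi>(2) c by blast
    moreover have "x = (x \<ominus>\<^bsub>M\<^esub> \<phi> c) \<oplus>\<^bsub>M\<^esub> \<phi> c"
      using WD(3)[OF x] WD(3)[OF \<phi>(2)[OF c(1)]] by (simp add: M.minus_eq M.a_assoc M.l_neg)
    ultimately show ?thesis using c by blast
  qed
  have ker: "f (\<phi> c) \<in> U" if "c \<in> ?F" "g c = \<zero>\<^bsub>X\<^esub>" for c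
    using hV[OF \<phi>(2)[OF that(1)]] \<phi>(3)[OF that(1)] that(2) fV by auto
  have sum: "U <+>\<^bsub>N\<^esub> f ` W = U <+>\<^bsub>N\<^esub> (\<lambda>c. f (\<phi> c)) ` ?F"
  proof
    have im: "submodule ((\<lambda>c. f (\<phi> c)) ` ?F) R N" using free_image_submodule[OF N f\<phi>] .
    note S = N.submodule_set_add[OF U im] and upper = N.set_add_upper[OF U im]
    have "f x \<in> U <+>\<^bsub>N\<^esub> (\<lambda>c. f (\<phi> c)) ` ?F" if "x \<in> W" for x
    proof -
      obtain c v where c: "c \<in> ?F" "v \<in> V" "x = v \<oplus>\<^bsub>M\<^esub> \<phi> c" using split \<open>x \<in> W\<close> by blast
      then have "f x = f v \<oplus>\<^bsub>N\<^esub> f (\<phi> c)" using fD(2) VD(3) WD(3) \<phi>(2) by simp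
      then show ?thesis using c fV unfolding set_add_def' by blast
    qed
    then show "U <+>\<^bsub>N\<^esub> f ` W \<subseteq> U <+>\<^bsub>N\<^esub> (\<lambda>c. f (\<phi> c)) ` ?F"
      using upper by (intro N.set_add_least[OF S]) auto
    show "U <+>\<^bsub>N\<^esub> (\<lambda>c. f (\<phi> c)) ` ?F \<subseteq> U <+>\<^bsub>N\<^esub> f ` W"
      using \<phi>(2) unfolding set_add_def' by blast
  qed
  have nz': "\<not> (\<lambda>c. f (\<phi> c)) ` ?F \<subseteq> U"
  proof
    assume "(\<lambda>c. f (\<phi> c)) ` ?F \<subseteq> U"
    then have "U <+>\<^bsub>N\<^esub> f ` W \<subseteq> U" unfolding sum by (intro N.set_add_least[OF U]) auto
    then show False
      using nz N.set_add_upper(2)[OF U submodule_hom_image[OF M N f W]] by blast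
  qed
  note * = goodD[OF good \<open>X \<in> \<X>\<close> g f\<phi> ker nz']
  show "good R \<X> N (U <+>\<^bsub>N\<^esub> f ` W)" using *(2) unfolding sum by simp
  fix x assume x: "x \<in> W" "f x \<in> U"
  obtain c v where c: "c \<in> ?F" "v \<in> V" "x = v \<oplus>\<^bsub>M\<^esub> \<phi> c" using split x(1) by blast
  have "f x = f v \<oplus>\<^bsub>N\<^esub> f (\<phi> c)" using c fD(2) VD(3) WD(3) \<phi>(2) by simp
  then have "f (\<phi> c) = \<ominus>\<^bsub>N\<^esub> f v \<oplus>\<^bsub>N\<^esub> f x"
    using c fD(1) VD(3) WD(3) \<phi>(2) by (simp add: N.r_neg1)
  moreover have "f v \<in> U" using c fV by blast
  ultimately have "f (\<phi> c) \<in> U" using UD(4,5) x(2) by metis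
  then have "g c = \<zero>\<^bsub>X\<^esub>" using *(1) c(1) by blast
  then have "\<phi> c \<in> V" using hV \<phi>(2,3) c(1) by metis
  then show "x \<in> V" using c VD(4) by simp
qed

section \<open>Towers over a semibrick\<close>

text \<open>Schur's lemma: orthogonality excludes nonzero maps between different members, and a
  nonzero endomorphism of a brick is a unit of its endomorphism ring.\<close>

lemma semibrick_hom:
  assumes \<X>: "semibrick R \<X>" and X: "X \<in> \<X>" and Y: "Y \<in> \<X>" and u: "u \<in> lmod_hom R X Y"
    and nz: "x \<in> carrier X" "u x \<noteq> \<zero>\<^bsub>Y\<^esub>"
  shows "X = Y" "bij_betw u (carrier X) (carrier Y)"
proof -
  show XY: "X = Y"
  proof (rule ccontr)
    assume "X \<noteq> Y"
    then have "hom_zero R X Y" using \<X> X Y unfolding semibrick_def orthogonal_bricks_def by blast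
    then show False using u nz unfolding hom_zero_def by blast
  qed
  \<comment> \<open>The elements of \<open>lmod_End\<close> are extensional, so \<open>u\<close> has
    to be cut down to the carrier first.\<close>
  define v where "v = restrict u (carrier X)"
  have div: "division_ring (lmod_End R X)" using \<X> X unfolding semibrick_def brick_def by blast
  have "left_module R X" using \<X> X unfolding semibrick_def brick_def by blast
  then interpret X: left_module R X .
  have "v \<in> lmod_hom R X X"
    using lmod_homD[OF u[folded XY]] by (intro lmod_homI) (simp_all add: v_def)
  then have "v \<in> carrier (lmod_End R X)" by (simp add: lmod_End_def v_def)
  moreover have "v \<noteq> \<zero>\<^bsub>lmod_End R X\<^esub>"
  proof
    assume "v = \<zero>\<^bsub>lmod_End R X\<^esub>"
    then have "v x = \<zero>\<^bsub>X\<^esub>" using nz(1) by (simp add: lmod_End_def)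
    then show False using nz XY by (simp add: v_def)
  qed
  ultimately have "v \<in> Units (lmod_End R X)" using div unfolding division_ring_def by simp
  then obtain w where w: "w \<in> lmod_hom R X X" "compose (carrier X) w v = (\<lambda>x\<in>carrier X. x)"
    "compose (carrier X) v w = (\<lambda>x\<in>carrier X. x)"
    unfolding Units_def by (auto simp: lmod_End_def)
  have 1: "w (u x) = x" if "x \<in> carrier X" for x
    using fun_cong[OF w(2), of x] that by (simp add: compose_def v_def)
  have 2: "u (w x) = x" if "x \<in> carrier X" for x
    using fun_cong[OF w(3), of x] that lmod_homD(1)[OF w(1)] by (simp add: compose_def v_def)
  show "bij_betw u (carrier X) (carrier Y)"
    by (rule bij_betw_byWitness[where f' = w])
      (use 1 2 XY lmod_homD(1)[OF u] lmod_homD(1)[OF w(1)] in auto)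
qed

text \<open>Successor members are submodules by the definition of \<open>factor\<close>, limit
  members as unions of chains.\<close>

lemma tower_factor_submodule:
  assumes M: "left_module R M" and t: "tower (factor R \<X> M) \<C> A B" and A: "submodule A R M"
    and C: "C \<in> \<C>"
  shows "submodule C R M"
  using C
proof (induction rule: tower_induct[OF t, consumes 1, case_names bot suc lim])
  case (suc D C)
  then show ?case unfolding factor_def by blast
next
  case (lim C)
  have "A \<in> {D\<in>\<C>. D \<subset> C}" using tower_bot[OF t] tower_ge[OF t lim(1)] lim(2) by auto
  then have "submodule (\<Union>{D\<in>\<C>. D \<subset> C}) R M"
    using lim(4) tower_linear[OF t] by (intro left_module.submodule_Union_chain[OF M]) auto
  then show ?case using lim(3) by simp
qed (fact A)

text \<open>A nonzero map from \<open>X\<close> to \<open>N/U\<close> first appears, the image being finitely generated, at a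
  successor step \<open>V \<subset> W\<close> of the tower, where it becomes an isomorphism onto \<open>W/V\<close>. So it splits
  off \<open>W/U\<close>, and the steps below \<open>V\<close> can be shifted by its image.\<close>

lemma tower_good:
  assumes \<X>: "semibrick R \<X>" and N: "left_module R N"
    and t: "tower (factor R \<X> N) \<C> U (carrier N)" and U: "submodule U R N"
  shows "good R \<X> N U"
proof -
  interpret N: left_module R N by fact
  have lm\<X>: "left_module R X" if "X \<in> \<X>" for X
    using \<X> that unfolding semibrick_def brick_def by blast
  \<comment> \<open>\<open>P\<close> collects the submodules with filtered quotient. The point to
    verify is that dividing out the image of a brick keeps the quotient filtered.\<close>
  define P where "P U \<longleftrightarrow> submodule U R N \<and> (\<exists>\<C>. tower (factor R \<X> N) \<C> U (carrier N))" for U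
  show ?thesis
  proof (rule good_coinduct_rule[where P = P])
    show "P U" unfolding P_def using t U by blast
    show "submodule U R N" if "P U" for U using that unfolding P_def by blast
    fix U X n g \<phi>
    assume "P U" and X: "X \<in> \<X>" "presents R X n g" and \<phi>: "\<phi> \<in> lmod_hom R (free_lmod R n) N"
      and ker: "\<And>c. c \<in> carrier (free_lmod R n) \<Longrightarrow> g c = \<zero>\<^bsub>X\<^esub> \<Longrightarrow> \<phi> c \<in> U"
      and nz: "\<not> \<phi> ` carrier (free_lmod R n) \<subseteq> U"
    let ?F = "carrier (free_lmod R n)" and ?S = "\<phi> ` carrier (free_lmod R n)"
    have lmF: "left_module R (free_lmod R n)" by (rule left_module_free) (rule N.R.ring_axioms)
    interpret F: left_module R "free_lmod R n" by (fact lmF)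
    from \<open>P U\<close> obtain \<C> where t: "tower (factor R \<X> N) \<C> U (carrier N)" and U: "submodule U R N"
      unfolding P_def by blast
    note sub = tower_factor_submodule[OF N t U]
    have S: "submodule ?S R N" using free_image_submodule[OF N \<phi>] .
    \<comment> \<open>\<open>W\<close> is the first member containing the image \<open>?S\<close>,
      and \<open>V\<close> will be its predecessor. \<open>W\<close> is not a union of smaller
      members: \<open>?S\<close> is finitely generated, so one of those would already contain
      it.\<close>
    obtain W where W: "W \<in> \<C>" "?S \<subseteq> W" and least: "\<And>C. C \<in> \<C> \<Longrightarrow> ?S \<subseteq> C \<Longrightarrow> W \<subseteq> C"
      using tower_least[OF t tower_top[OF t], of "\<lambda>C. ?S \<subseteq> C"] N.submoduleD(1)[OF S] by metis
    obtain V where V: "V \<in> \<C>" "V \<subset> W" and fac: "factor R \<X> N V W"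
      using W(1)
    proof (cases rule: tower_cases[OF t, consumes 1])
      case 1
      then show ?thesis using W(2) nz by simp
    next
      case 2
      let ?\<D> = "{D\<in>\<C>. D \<subset> W}"
      have "U \<in> ?\<D>" using tower_bot[OF t] tower_ge[OF t W(1)] 2(1) by auto
      then have ne: "?\<D> \<noteq> {}" by blast
      have "?S \<subseteq> \<Union>?\<D>" using W(2) 2(2) by simp
      from free_hom_into_chain_Union[OF N \<phi> _ ne _ this] obtain D where "D \<in> ?\<D>" "?S \<subseteq> D"
        using sub tower_linear[OF t] by (metis (no_types, lifting) mem_Collect_eq)
      then show ?thesis using least[of D] by auto
    qed (use that in blast)
    obtain Y h where Vs: "submodule V R N" and Ws: "submodule W R N" and "V \<subseteq> W" and Y: "Y \<in> \<X>"
      and h: "h \<in> lmod_hom R (N\<lparr>carrier := W\<rparr>) Y" and surj: "h ` W = carrier Y"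
      and hV: "\<And>x. x \<in> W \<Longrightarrow> h x = \<zero>\<^bsub>Y\<^esub> \<longleftrightarrow> x \<in> V"
      using factorE[OF fac] by metis
    have ghom: "g \<in> lmod_hom R (free_lmod R n) X" and gsurj: "g ` ?F = carrier X"
      using X(2) unfolding presents_def by auto
    interpret X: left_module R X by (rule lm\<X>) fact
    interpret Y: left_module R Y by (rule lm\<X>) fact
    note hD = lmod_hom_sub[OF N lm\<X>[OF Y] Ws h]
      and gD = lmod_homD[OF ghom] lmod_hom_arith[OF lmF lm\<X>[OF X(1)] ghom]
      and \<phi>D = lmod_homD[OF \<phi>] lmod_hom_arith[OF lmF N \<phi>]
      and WD = N.submoduleD[OF Ws] and VD = N.submoduleD[OF Vs]
    have UV: "U \<subseteq> V" using tower_ge[OF t V(1)] .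
    have \<phi>W: "\<phi> c \<in> W" if "c \<in> ?F" for c using W(2) that by blast
    \<comment> \<open>\<open>u\<close> is the homomorphism from \<open>X\<close> to
      \<open>W/V \<cong> Y\<close> induced by \<open>\<phi>\<close>. The choice of lifts along
      \<open>g\<close> does not matter, as \<open>ug\<close> shows, because \<open>\<phi>\<close>
      maps the kernel of \<open>g\<close> into \<open>U \<subseteq> V\<close>.\<close>
    define u where "u x = h (\<phi> (inv_into ?F g x))" for x
    have ug: "u (g c) = h (\<phi> c)" if c: "c \<in> ?F" for c
    proof -
      define d where "d = inv_into ?F g (g c)"
      have d: "d \<in> ?F" "g d = g c"
        unfolding d_def using c by (simp_all add: inv_into_into f_inv_into_f del: free_lmod_simps)
      have "g (d \<ominus>\<^bsub>free_lmod R n\<^esub> c) = \<zero>\<^bsub>X\<^esub>"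
        using gD(6)[OF d(1) c] d(2) gD(1)[OF c] by (simp add: X.minus_eq X.r_neg)
      then have "\<phi> (d \<ominus>\<^bsub>free_lmod R n\<^esub> c) \<in> V" using ker UV F.minus_closed[OF d(1) c] by blast
      then have "\<phi> d \<ominus>\<^bsub>N\<^esub> \<phi> c \<in> V" using \<phi>D(6)[OF d(1) c] by simp
      then have "h (\<phi> d \<ominus>\<^bsub>N\<^esub> \<phi> c) = \<zero>\<^bsub>Y\<^esub>" using hV \<open>V \<subseteq> W\<close> by blast
      then have "h (\<phi> d) \<ominus>\<^bsub>Y\<^esub> h (\<phi> c) = \<zero>\<^bsub>Y\<^esub>" using hD(3)[OF \<phi>W \<phi>W] d(1) c by simp
      then have "h (\<phi> d) = h (\<phi> c)" using Y.diff_eq_zeroD hD(6)[OF \<phi>W] d(1) c by blast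
      then show ?thesis unfolding u_def d_def .
    qed
    have rep: "\<exists>c\<in>?F. x = g c" if "x \<in> carrier X" for x using that gsurj by blast
    have u: "u \<in> lmod_hom R X Y"
    proof (rule lmod_homI)
      fix x assume "x \<in> carrier X"
      then obtain c where c: "c \<in> ?F" "x = g c" using rep by blast
      show "u x \<in> carrier Y" using c ug hD(6) \<phi>W by metis
      show "u (a \<odot>\<^bsub>X\<^esub> x) = a \<odot>\<^bsub>Y\<^esub> u x" if a: "a \<in> carrier R" for a
      proof -
        have "u (a \<odot>\<^bsub>X\<^esub> x) = h (\<phi> (a \<odot>\<^bsub>free_lmod R n\<^esub> c))"
          using ug[OF F.smult_closed[OF a c(1)]] gD(3)[OF a c(1)] c(2) by metis
        then show ?thesis using \<phi>D(3)[OF a c(1)] hD(5)[OF a \<phi>W[OF c(1)]] ug[OF c(1)] c(2) by metis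
      qed
      fix y assume "y \<in> carrier X"
      then obtain d where d: "d \<in> ?F" "y = g d" using rep by blast
      have "u (x \<oplus>\<^bsub>X\<^esub> y) = h (\<phi> (c \<oplus>\<^bsub>free_lmod R n\<^esub> d))"
        using ug[OF F.a_closed[OF c(1) d(1)]] gD(2)[OF c(1) d(1)] c(2) d(2) by metis
      then show "u (x \<oplus>\<^bsub>X\<^esub> y) = u x \<oplus>\<^bsub>Y\<^esub> u y"
        using \<phi>D(2)[OF c(1) d(1)] hD(4)[OF \<phi>W[OF c(1)] \<phi>W[OF d(1)]] ug[OF c(1)] ug[OF d(1)] c(2) d(2)
        by metis
    qed
    have "\<not> ?S \<subseteq> V" using least[OF V(1)] V(2) by blast
    then obtain c where c: "c \<in> ?F" "\<phi> c \<notin> V" by blast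
    then have "u (g c) \<noteq> \<zero>\<^bsub>Y\<^esub>" using ug[OF c(1)] hV[OF \<phi>W[OF c(1)]] by simp
    \<comment> \<open>Now \<open>u\<close> is bijective. Injectivity will say that \<open>?S\<close>
      meets \<open>V\<close> only inside \<open>U\<close>, surjectivity that \<open>V\<close> and
      \<open>?S\<close> together span \<open>W\<close>.\<close>
    note bij = semibrick_hom(2)[OF \<X> X(1) Y u gD(1)[OF c(1)] this]
    have u0: "u \<zero>\<^bsub>X\<^esub> = \<zero>\<^bsub>Y\<^esub>" using lmod_hom_arith(1)[OF lm\<X>[OF X(1)] lm\<X>[OF Y] u] .
    have inj: "g c = \<zero>\<^bsub>X\<^esub>" if c: "c \<in> ?F" "\<phi> c \<in> V" for c
    proof -
      have "u (g c) = u \<zero>\<^bsub>X\<^esub>" using ug[OF c(1)] hV[OF \<phi>W[OF c(1)]] c(2) u0 by simp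
      then show ?thesis
        using bij gD(1)[OF c(1)] X.zero_closed unfolding bij_betw_def by (meson inj_onD)
    qed
    have VS: "V <+>\<^bsub>N\<^esub> ?S = W"
    proof
      show "V <+>\<^bsub>N\<^esub> ?S \<subseteq> W" by (rule N.set_add_least[OF Ws \<open>V \<subseteq> W\<close> W(2)])
      show "W \<subseteq> V <+>\<^bsub>N\<^esub> ?S"
      proof
        fix w assume w: "w \<in> W"
        have "h w \<in> u ` carrier X" using bij hD(6)[OF w] unfolding bij_betw_def by simp
        then obtain c where c: "c \<in> ?F" "h w = h (\<phi> c)" using rep ug by (metis imageE)
        have "h (w \<ominus>\<^bsub>N\<^esub> \<phi> c) = \<zero>\<^bsub>Y\<^esub>"
          using hD(3)[OF w \<phi>W[OF c(1)]] c(2) hD(6)[OF \<phi>W[OF c(1)]] by (simp add: Y.minus_eq Y.r_neg)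
        then have "w \<ominus>\<^bsub>N\<^esub> \<phi> c \<in> V" using hV WD(7)[OF w \<phi>W[OF c(1)]] by blast
        moreover have "w = (w \<ominus>\<^bsub>N\<^esub> \<phi> c) \<oplus>\<^bsub>N\<^esub> \<phi> c"
          using WD(3)[OF w] \<phi>D(1)[OF c(1)] by (simp add: N.minus_eq N.a_assoc N.l_neg)
        ultimately show "w \<in> V <+>\<^bsub>N\<^esub> ?S" using c(1) unfolding set_add_def' by blast
      qed
    qed
    \<comment> \<open>The part from \<open>U\<close> to \<open>V\<close>, shifted by
      \<open>?S\<close>, runs from \<open>U + ?S\<close> to \<open>W\<close>. Its factors do not
      change: for \<open>C \<subset> D\<close> in this part, \<open>D\<close> meets
      \<open>C + ?S\<close> only in \<open>C\<close>, since elements of \<open>?S\<close> in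
      \<open>V\<close> lie in \<open>U \<subseteq> C\<close>.\<close>
    have "tower (factor R \<X> N) ((\<lambda>C. C <+>\<^bsub>N\<^esub> ?S) ` {C\<in>\<C>. C \<subseteq> V}) (U <+>\<^bsub>N\<^esub> ?S) (V <+>\<^bsub>N\<^esub> ?S)"
    proof (rule tower_image[OF tower_below[OF t V(1)]])
      show "C <+>\<^bsub>N\<^esub> ?S \<subseteq> D <+>\<^bsub>N\<^esub> ?S" if "C \<subseteq> D" for C D
        using that unfolding set_add_def' by blast
      show "(\<Union>\<D>) <+>\<^bsub>N\<^esub> ?S \<subseteq> (\<Union>D\<in>\<D>. D <+>\<^bsub>N\<^esub> ?S)" for \<D> unfolding set_add_def' by blast
      fix C D assume CD: "C \<in> {C\<in>\<C>. C \<subseteq> V}" "D \<in> {C\<in>\<C>. C \<subseteq> V}" "factor R \<X> N C D" "C \<subset> D"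
      have Cs: "submodule C R N" and Ds: "submodule D R N" using CD sub by auto
      have "factor R \<X> N (C <+>\<^bsub>N\<^esub> ?S) ((C <+>\<^bsub>N\<^esub> ?S) <+>\<^bsub>N\<^esub> (\<lambda>x. x) ` D)"
      proof (rule factor_push[OF N N lm\<X> lmod_hom_id CD(3) N.submodule_set_add[OF Cs S]])
        fix x assume x: "x \<in> D"
        show "x \<in> C <+>\<^bsub>N\<^esub> ?S \<longleftrightarrow> x \<in> C"
        proof
          assume "x \<in> C <+>\<^bsub>N\<^esub> ?S"
          then obtain y c where y: "y \<in> C" "c \<in> ?F" "x = y \<oplus>\<^bsub>N\<^esub> \<phi> c" unfolding set_add_def' by blast
          have "x \<in> V" "y \<in> V" using x y CD by auto
          have "\<phi> c = \<ominus>\<^bsub>N\<^esub> y \<oplus>\<^bsub>N\<^esub> x"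
            using y(3) VD(3)[OF \<open>y \<in> V\<close>] \<phi>D(1)[OF y(2)] by (simp add: N.r_neg1)
          then have "\<phi> c \<in> V" using VD(4)[OF VD(5)[OF \<open>y \<in> V\<close>] \<open>x \<in> V\<close>] by simp
          then have "\<phi> c \<in> U" using inj ker y(2) by blast
          then have "\<phi> c \<in> C" using tower_ge[OF t, of C] CD(1) by blast
          then show "x \<in> C" using N.submoduleD(4)[OF Cs y(1)] y(3) by simp
        qed (use N.set_add_upper(1)[OF Cs S] in blast)
      qed
      then show "factor R \<X> N (C <+>\<^bsub>N\<^esub> ?S) (D <+>\<^bsub>N\<^esub> ?S)"
        using N.set_add_assoc_absorb(2)[OF S Cs Ds] CD(4) by (simp del: free_lmod_simps)
    qed
    \<comment> \<open>Above \<open>W\<close> the old tower is kept. The step from \<open>V\<close>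
      to \<open>W\<close> is the one that has been divided out.\<close>
    then have "tower (factor R \<X> N)
        ((\<lambda>C. C <+>\<^bsub>N\<^esub> ?S) ` {C\<in>\<C>. C \<subseteq> V} \<union> {C\<in>\<C>. W \<subseteq> C}) (U <+>\<^bsub>N\<^esub> ?S) (carrier N)"
      unfolding VS by (rule tower_append) (rule tower_above[OF t W(1)])
    then show "(\<forall>c\<in>?F. \<phi> c \<in> U \<longrightarrow> g c = \<zero>\<^bsub>X\<^esub>) \<and> P (U <+>\<^bsub>N\<^esub> ?S)"
      unfolding P_def using N.submodule_set_add[OF U S] inj UV by blast
  qed
qed

text \<open>Transfinite induction along the filtration of \<open>M\<close>, with
  \<open>good_step\<close> at successors and \<open>good_chain_Union\<close> at limits. For the
  kernel \<open>A\<close> is zero, for the cokernel it is a member of the filtration of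
  \<open>N\<close>.\<close>

lemma good_add_image:
  assumes \<X>: "\<And>X. X \<in> \<X> \<Longrightarrow> brick R X" and M: "left_module R M" and N: "left_module R N"
    and f: "f \<in> lmod_hom R M N" and good: "good R \<X> N A"
    and t: "tower (factor R \<X> M) \<C> {\<zero>\<^bsub>M\<^esub>} B" and C: "C \<in> \<C>"
  shows "good R \<X> N (A <+>\<^bsub>N\<^esub> f ` C)"
proof -
  interpret M: left_module R M by fact
  interpret N: left_module R N by fact
  note A = good_submodule[OF good]
  note sub = tower_factor_submodule[OF M t M.submodule_zero]
  note fsub = submodule_hom_image[OF M N f]
  show ?thesis
    using C
  proof (induction rule: tower_induct[OF t, consumes 1, case_names bot suc lim])
    case bot
    have "A <+>\<^bsub>N\<^esub> {\<zero>\<^bsub>N\<^esub>} = A"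
      using N.submoduleD(2)[OF A] by (intro N.set_add_absorb_left[OF N.submodule_zero A]) auto
    then show ?case using good lmod_hom_arith(1)[OF M N f] by simp
  next
    case (suc D C)
    note Ds = fsub[OF sub[OF suc(1)]] and Cs = fsub[OF sub[OF suc(2)]]
    have "D \<subseteq> C" using suc(3) unfolding factor_def by blast
    then have DC: "f ` D \<subseteq> f ` C" by blast
    let ?U = "A <+>\<^bsub>N\<^esub> f ` D"
    have fD: "f ` D \<subseteq> ?U" using N.set_add_upper(2)[OF A Ds] .
    have eq: "?U <+>\<^bsub>N\<^esub> f ` C = A <+>\<^bsub>N\<^esub> f ` C"
      using N.set_add_assoc_absorb(1)[OF A Ds Cs DC] .
    show ?case
    proof (cases "f ` C \<subseteq> ?U")
      case True
      then have "?U <+>\<^bsub>N\<^esub> f ` C = ?U"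
        by (rule N.set_add_absorb_left[OF Cs N.submodule_set_add[OF A Ds]])
      then show ?thesis using suc(4) eq by simp
    next
      case False
      then show ?thesis using good_step(2)[OF M N \<X> f suc(3,4) fD] eq by simp
    qed
  next
    case (lim C)
    let ?\<U> = "(\<lambda>D. A <+>\<^bsub>N\<^esub> f ` D) ` {D\<in>\<C>. D \<subset> C}"
    have "{\<zero>\<^bsub>M\<^esub>} \<in> {D\<in>\<C>. D \<subset> C}" using tower_bot[OF t] tower_ge[OF t lim(1)] lim(2) by auto
    moreover have "U \<subseteq> V \<or> V \<subseteq> U" if UV: "U \<in> ?\<U>" "V \<in> ?\<U>" for U V
    proof -
      obtain D E where D: "U = A <+>\<^bsub>N\<^esub> f ` D" "V = A <+>\<^bsub>N\<^esub> f ` E" "D \<in> \<C>" "E \<in> \<C>"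
        using UV by blast
      from tower_linear[OF t D(3,4)] show ?thesis unfolding D(1,2) set_add_def' by blast
    qed
    ultimately have "good R \<X> N (\<Union>?\<U>)"
      using lim(4) by (intro good_chain_Union[OF N]) auto
    moreover have "A <+>\<^bsub>N\<^esub> f ` (\<Union>{D\<in>\<C>. D \<subset> C}) = \<Union>?\<U>" unfolding set_add_def' by blast
    ultimately show ?case using lim(3) by simp
  qed
qed

section \<open>Filtrations and towers\<close>

lemma left_module_submodule:
  assumes M: "left_module R M" and W: "submodule W R M"
  shows "left_module R (M\<lparr>carrier := W\<rparr>)"
proof -
  interpret M: left_module R M by fact
  note W = M.submoduleD[OF W]
  have "abelian_group (M\<lparr>carrier := W\<rparr>)"
  proof (rule abelian_groupI; simp)
    fix x y z assume "x \<in> W" "y \<in> W" "z \<in> W"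
    then show "x \<oplus>\<^bsub>M\<^esub> y \<oplus>\<^bsub>M\<^esub> z = x \<oplus>\<^bsub>M\<^esub> (y \<oplus>\<^bsub>M\<^esub> z)" "x \<oplus>\<^bsub>M\<^esub> y = y \<oplus>\<^bsub>M\<^esub> x"
      using W(3) by (simp_all add: M.a_ac)
  next
    fix x assume x: "x \<in> W"
    then show "\<exists>y\<in>W. y \<oplus>\<^bsub>M\<^esub> x = \<zero>\<^bsub>M\<^esub>" using W(3,5) by (intro bexI[of _ "\<ominus>\<^bsub>M\<^esub> x"]) (simp_all add: M.l_neg)
  qed (use W in simp_all)
  then show ?thesis
    by (intro left_module.intro M.R.ring_axioms left_module_axioms.intro)
      (use W in \<open>simp_all add: M.smult_l_distr M.smult_r_distr M.smult_assoc1\<close>)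
qed

lemma submodule_of_submodule:
  assumes M: "left_module R M" and W: "submodule W R M" and V: "submodule V R M" and "V \<subseteq> W"
  shows "submodule V R (M\<lparr>carrier := W\<rparr>)"
  using left_module.submoduleD[OF M V] \<open>V \<subseteq> W\<close>
  by (intro left_module.submoduleI[OF left_module_submodule[OF M W]]) auto

lemma lmod_quot_simps [simp]:
  "carrier (lmod_quot M V) = a_rcosets\<^bsub>M\<^esub> V"
  "\<zero>\<^bsub>lmod_quot M V\<^esub> = V"
  "A \<oplus>\<^bsub>lmod_quot M V\<^esub> B = A <+>\<^bsub>M\<^esub> B"
  "a \<odot>\<^bsub>lmod_quot M V\<^esub> A = (\<Union>x\<in>A. V +>\<^bsub>M\<^esub> (a \<odot>\<^bsub>M\<^esub> x))"
  by (simp_all add: lmod_quot_def)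

section \<open>Cosets and the first isomorphism theorem\<close>

context
  fixes R :: "('r, 's) ring_scheme" and M :: "('r, 'm) module" and V
  assumes M: "left_module R M" and V: "submodule V R M"
begin

interpretation M: left_module R M by (fact M)
interpretation V: abelian_subgroup V M
  using V unfolding submodule_def
  by (intro abelian_subgroupI3 additive_subgroup.intro M.M.abelian_group_axioms) simp

lemma mem_coset: "y \<in> V +>\<^bsub>M\<^esub> x \<longleftrightarrow> (\<exists>v\<in>V. y = v \<oplus>\<^bsub>M\<^esub> x)"
  by (auto simp: a_r_coset_def')

lemma coset_eq_iff:
  assumes "x \<in> carrier M" "y \<in> carrier M"
  shows "V +>\<^bsub>M\<^esub> x = V +>\<^bsub>M\<^esub> y \<longleftrightarrow> x \<ominus>\<^bsub>M\<^esub> y \<in> V"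
proof
  assume "V +>\<^bsub>M\<^esub> x = V +>\<^bsub>M\<^esub> y"
  then have "x \<in> V +>\<^bsub>M\<^esub> y" using V.a_rcos_self[OF assms(1)] by simp
  then obtain v where "v \<in> V" "x = v \<oplus>\<^bsub>M\<^esub> y" unfolding mem_coset by blast
  then show "x \<ominus>\<^bsub>M\<^esub> y \<in> V"
    using assms M.submoduleD(3)[OF V] by (simp add: M.minus_eq M.a_assoc M.r_neg)
next
  assume *: "x \<ominus>\<^bsub>M\<^esub> y \<in> V"
  have "x = (x \<ominus>\<^bsub>M\<^esub> y) \<oplus>\<^bsub>M\<^esub> y" using assms by (simp add: M.minus_eq M.a_assoc M.l_neg)
  then have "x \<in> V +>\<^bsub>M\<^esub> y" using * unfolding mem_coset by blast
  then show "V +>\<^bsub>M\<^esub> x = V +>\<^bsub>M\<^esub> y"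
    using V.a_repr_independence'[OF _ assms(2)] by simp
qed

text \<open>The scalar multiplication of \<open>lmod_quot\<close> is a union over all
  representatives of a coset; they all contribute the same coset.\<close>

lemma smult_coset:
  assumes "a \<in> carrier R" "x \<in> carrier M"
  shows "(\<Union>y\<in>V +>\<^bsub>M\<^esub> x. V +>\<^bsub>M\<^esub> (a \<odot>\<^bsub>M\<^esub> y)) = V +>\<^bsub>M\<^esub> (a \<odot>\<^bsub>M\<^esub> x)"
proof -
  have "V +>\<^bsub>M\<^esub> (a \<odot>\<^bsub>M\<^esub> y) = V +>\<^bsub>M\<^esub> (a \<odot>\<^bsub>M\<^esub> x)" if y: "y \<in> V +>\<^bsub>M\<^esub> x" for y
  proof -
    obtain v where v: "v \<in> V" "y = v \<oplus>\<^bsub>M\<^esub> x" using y unfolding mem_coset by blast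
    note vM = M.submoduleD(3)[OF V v(1)]
    have "a \<odot>\<^bsub>M\<^esub> y \<ominus>\<^bsub>M\<^esub> a \<odot>\<^bsub>M\<^esub> x = a \<odot>\<^bsub>M\<^esub> v"
      using assms vM v(2) by (simp add: M.smult_r_distr M.minus_eq M.a_assoc M.r_neg)
    then show ?thesis
      using assms vM v M.submoduleD(6)[OF V assms(1) v(1)] by (subst coset_eq_iff) auto
  qed
  then show ?thesis using V.a_rcos_self[OF assms(2)] by blast
qed

lemma coset_hom: "(\<lambda>x. V +>\<^bsub>M\<^esub> x) \<in> lmod_hom R M (lmod_quot M V)"
  by (rule lmod_homI) (auto simp: A_RCOSETS_def' V.a_rcos_sum smult_coset)

lemma rcosets_eq_image: "a_rcosets\<^bsub>M\<^esub> V = (\<lambda>x. V +>\<^bsub>M\<^esub> x) ` carrier M"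
  by (auto simp: A_RCOSETS_def')

lemma epi_of_lmod_quot_iso:
  assumes X: "left_module R X" and k: "k \<in> lmod_hom R (lmod_quot M V) X"
    and bij: "bij_betw k (carrier (lmod_quot M V)) (carrier X)"
  obtains h where "h \<in> lmod_hom R M X" "h ` carrier M = carrier X"
    "\<And>x. x \<in> carrier M \<Longrightarrow> h x = \<zero>\<^bsub>X\<^esub> \<longleftrightarrow> x \<in> V"
proof (rule that)
  let ?h = "\<lambda>x. k (V +>\<^bsub>M\<^esub> x)"
  show h: "?h \<in> lmod_hom R M X" using lmod_hom_comp[OF coset_hom k] .
  show "?h ` carrier M = carrier X"
    using bij unfolding bij_betw_def by (simp add: rcosets_eq_image image_image)
  fix x assume x: "x \<in> carrier M"
  have "?h x = \<zero>\<^bsub>X\<^esub> \<longleftrightarrow> ?h x = ?h \<zero>\<^bsub>M\<^esub>" using lmod_hom_arith(1)[OF M X h] by simp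
  also have "\<dots> \<longleftrightarrow> V +>\<^bsub>M\<^esub> x = V +>\<^bsub>M\<^esub> \<zero>\<^bsub>M\<^esub>"
    using bij x unfolding bij_betw_def by (auto simp: rcosets_eq_image inj_on_eq_iff)
  also have "\<dots> \<longleftrightarrow> x \<ominus>\<^bsub>M\<^esub> \<zero>\<^bsub>M\<^esub> \<in> V" using x by (simp add: coset_eq_iff)
  also have "x \<ominus>\<^bsub>M\<^esub> \<zero>\<^bsub>M\<^esub> = x" using x
    by (metis M.M.a_inv_closed M.M.l_zero M.M.minus_eq M.M.r_neg M.M.r_zero M.M.zero_closed)
  finally show "?h x = \<zero>\<^bsub>X\<^esub> \<longleftrightarrow> x \<in> V" .
qed

text \<open>First isomorphism theorem: \<open>h\<close> is constant on cosets because it vanishes on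
  \<open>V\<close>, and different cosets have different values because it vanishes nowhere
  else.\<close>

lemma lmod_quot_iso_of_epi:
  assumes X: "left_module R X" and h: "h \<in> lmod_hom R M X" and surj: "h ` carrier M = carrier X"
    and ker: "\<And>x. x \<in> carrier M \<Longrightarrow> h x = \<zero>\<^bsub>X\<^esub> \<longleftrightarrow> x \<in> V"
  shows "lmod_isomorphic R (lmod_quot M V) X"
proof -
  interpret X: left_module R X by fact
  note hD = lmod_homD[OF h] lmod_hom_arith[OF M X h]
  have eq: "h x = h y \<longleftrightarrow> x \<ominus>\<^bsub>M\<^esub> y \<in> V" if "x \<in> carrier M" "y \<in> carrier M" for x y
  proof -
    have "h x = h y \<longleftrightarrow> h x \<ominus>\<^bsub>X\<^esub> h y = \<zero>\<^bsub>X\<^esub>"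
      using X.diff_eq_zeroD hD(1) that by (auto simp: X.minus_eq X.r_neg)
    then show ?thesis using ker hD(6) that M.minus_closed by metis
  qed
  define k where "k A = h (SOME x. x \<in> A)" for A
  have k: "k (V +>\<^bsub>M\<^esub> x) = h x" if x: "x \<in> carrier M" for x
  proof -
    have "(SOME y. y \<in> V +>\<^bsub>M\<^esub> x) \<in> V +>\<^bsub>M\<^esub> x"
      by (rule someI) (rule V.a_rcos_self[OF x])
    then obtain v where v: "v \<in> V" "(SOME y. y \<in> V +>\<^bsub>M\<^esub> x) = v \<oplus>\<^bsub>M\<^esub> x" unfolding mem_coset by blast
    have "v \<in> carrier M" using v M.submoduleD(3)[OF V] by blast
    then show ?thesis unfolding k_def v(2) using hD(1,2) x ker[of v] v(1) by simp
  qed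
  have "k \<in> lmod_hom R (lmod_quot M V) X"
    by (rule lmod_homI) (use k hD in \<open>auto simp: rcosets_eq_image V.a_rcos_sum smult_coset\<close>)
  moreover have "bij_betw k (a_rcosets\<^bsub>M\<^esub> V) (carrier X)"
    unfolding bij_betw_def inj_on_def rcosets_eq_image using k surj
    by (auto simp: image_image eq coset_eq_iff)
  ultimately show ?thesis unfolding lmod_isomorphic_def by auto
qed

end

lemma factor_iff_lmod_isomorphic:
  assumes M: "left_module R M" and \<X>: "\<And>X. X \<in> \<X> \<Longrightarrow> left_module R X"
    and V: "submodule V R M" and W: "submodule W R M" and "V \<subseteq> W"
  shows "factor R \<X> M V W \<longleftrightarrow> (\<exists>X\<in>\<X>. lmod_isomorphic R (lmod_quot (M\<lparr>carrier := W\<rparr>) V) X)"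
proof
  note lmW = left_module_submodule[OF M W] and VW = submodule_of_submodule[OF M W V \<open>V \<subseteq> W\<close>]
  {
    assume "factor R \<X> M V W"
    then obtain X h where X: "X \<in> \<X>" and h: "h \<in> lmod_hom R (M\<lparr>carrier := W\<rparr>) X" "h ` W = carrier X"
      "\<And>x. x \<in> W \<Longrightarrow> h x = \<zero>\<^bsub>X\<^esub> \<longleftrightarrow> x \<in> V" using factorE by metis
    then have "lmod_isomorphic R (lmod_quot (M\<lparr>carrier := W\<rparr>) V) X"
      by (intro lmod_quot_iso_of_epi[OF lmW VW \<X>[OF X] h(1)]) simp_all
    then show "\<exists>X\<in>\<X>. lmod_isomorphic R (lmod_quot (M\<lparr>carrier := W\<rparr>) V) X" using X by blast
  }
  assume "\<exists>X\<in>\<X>. lmod_isomorphic R (lmod_quot (M\<lparr>carrier := W\<rparr>) V) X"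
  then obtain X k where X: "X \<in> \<X>" and k: "k \<in> lmod_hom R (lmod_quot (M\<lparr>carrier := W\<rparr>) V) X"
    "bij_betw k (carrier (lmod_quot (M\<lparr>carrier := W\<rparr>) V)) (carrier X)"
    unfolding lmod_isomorphic_def by blast
  obtain h where h: "h \<in> lmod_hom R (M\<lparr>carrier := W\<rparr>) X" "h ` W = carrier X"
    "\<And>x. x \<in> W \<Longrightarrow> h x = \<zero>\<^bsub>X\<^esub> \<longleftrightarrow> x \<in> V"
    using epi_of_lmod_quot_iso[OF lmW VW \<X>[OF X] k] by auto
  show "factor R \<X> M V W"
    unfolding factor_def using V W \<open>V \<subseteq> W\<close> X h by blast
qed

lemma tower_of_class_filtration:
  fixes r :: "'i rel"
  assumes M: "left_module R M" and \<X>: "\<And>X. X \<in> \<X> \<Longrightarrow> left_module R X"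
    and cf: "class_filtration R \<X> M r F"
  shows "tower (factor R \<X> M) (F ` Field r) {\<zero>\<^bsub>M\<^esub>} (carrier M)"
proof -
  interpret M: left_module R M by fact
  have filt: "filtration R M r F" using cf unfolding class_filtration_def by (elim conjE)
  note filt = filt[unfolded filtration_def]
  have wo: "Well_order r" using filt by (elim conjE)
  have sub: "submodule (F i) R M" if "i \<in> Field r" for i using filt that by (elim conjE) (rule bspec)
  have mono: "F i \<subseteq> F j" if "(i, j) \<in> r" for i j using filt that by (elim conjE) iprover
  have bot: "F i = {\<zero>\<^bsub>M\<^esub>}" if "i \<in> Field r" "underS r i = {}" for i
    using filt that by (elim conjE) (drule (1) bspec, iprover)
  have top: "\<exists>i\<in>Field r. aboveS r i = {} \<and> F i = carrier M" using filt by (elim conjE)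
  have lim: "F j = (\<Union>i\<in>underS r j. F i)" if "wo_limit r j" for j
    using filt that by (elim conjE) iprover
  have fac: "\<exists>X\<in>\<X>. lmod_isomorphic R (lmod_quot (M\<lparr>carrier := F j\<rparr>) (F i)) X" if "wo_suc r i j" for i j
    using cf that unfolding class_filtration_def by (elim conjE) iprover
  interpret r: wo_rel r using wo by (simp add: wo_rel_def)
  have minimal: "\<exists>i\<in>Field r. P i \<and> (\<forall>k\<in>Field r. P k \<longrightarrow> (i, k) \<in> r)" if "j \<in> Field r" "P j" for P j
  proof -
    have "{i\<in>Field r. P i} \<subseteq> Field r" "{i\<in>Field r. P i} \<noteq> {}" using that by auto
    from r.minim_in[OF this] r.minim_least[OF this(1)] show ?thesis by blast
  qed
  obtain e where e: "e \<in> Field r" "F e = carrier M" using top by blast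
  obtain z where z: "z \<in> Field r" "\<And>k. k \<in> Field r \<Longrightarrow> (z, k) \<in> r"
    using minimal[OF e(1), of "\<lambda>_. True"] by blast
  have "underS r z = {}"
    using z(2) r.ANTISYM unfolding underS_def antisym_def Field_def by blast
  then have Fz: "F z = {\<zero>\<^bsub>M\<^esub>}" using bot z(1) by blast
  show ?thesis
  proof (rule towerI)
    show "{\<zero>\<^bsub>M\<^esub>} \<in> F ` Field r" using z(1) Fz by (metis image_eqI)
    show "carrier M \<in> F ` Field r" using e by (metis image_eqI)
    show "{\<zero>\<^bsub>M\<^esub>} \<subseteq> C" if "C \<in> F ` Field r" for C using that M.submoduleD(2)[OF sub] by auto
    show "C \<subseteq> carrier M" if "C \<in> F ` Field r" for C using that M.submoduleD(1)[OF sub] by auto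
    show "\<Inter>\<D> \<in> \<D>" if \<D>: "\<D> \<subseteq> F ` Field r" "\<D> \<noteq> {}" for \<D>
    proof -
      obtain i where "i \<in> Field r" "F i \<in> \<D>" using \<D> by blast
      from minimal[of i "\<lambda>i. F i \<in> \<D>", OF this] obtain i where i: "i \<in> Field r" "F i \<in> \<D>"
        "\<And>k. k \<in> Field r \<Longrightarrow> F k \<in> \<D> \<Longrightarrow> (i, k) \<in> r" by blast
      have "F i \<subseteq> D" if D: "D \<in> \<D>" for D
      proof -
        obtain k where "k \<in> Field r" "D = F k" using \<D>(1) D by blast
        then show ?thesis using i(3) mono D by blast
      qed
      then have "\<Inter>\<D> = F i" using i(2) by blast
      then show ?thesis using i(2) by simp
    qed
    fix C assume C: "C \<in> F ` Field r" "C \<noteq> {\<zero>\<^bsub>M\<^esub>}" "C \<noteq> \<Union>{D\<in>F ` Field r. D \<subset> C}"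
    then obtain j where "j \<in> Field r" "F j = C" by blast
    \<comment> \<open>Different indices may carry the same submodule, so \<open>C\<close> gets its
      least index. Smaller indices then give properly smaller submodules, and whether
      \<open>C\<close> is a union or has a predecessor can be read off from
      \<open>j\<close>.\<close>
    from minimal[of j "\<lambda>i. F i = C", OF this] obtain j where j: "j \<in> Field r" "F j = C"
      and least: "\<And>k. k \<in> Field r \<Longrightarrow> F k = C \<Longrightarrow> (j, k) \<in> r" by blast
    have below: "F k \<subset> C" "k \<in> Field r" if "k \<in> underS r j" for k
    proof -
      have k: "(k, j) \<in> r" "k \<noteq> j" using that unfolding underS_def by auto
      show "k \<in> Field r" using k(1) unfolding Field_def by blast
      have "(j, k) \<notin> r" using k r.ANTISYM unfolding antisym_def by blast
      then have "F k \<noteq> C" using least[OF \<open>k \<in> Field r\<close>] by blast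
      then show "F k \<subset> C" using mono[OF k(1)] j(2) by blast
    qed
    have "underS r j \<noteq> {}" using bot[OF j(1)] j(2) C(2) by blast
    moreover have "\<not> wo_limit r j"
    proof
      assume "wo_limit r j"
      from lim[OF this] have "C = (\<Union>i\<in>underS r j. F i)" using j(2) by simp
      also have "\<dots> \<subseteq> \<Union>{D\<in>F ` Field r. D \<subset> C}" using below by blast
      finally show False using C(3) by blast
    qed
    ultimately obtain i where i: "wo_suc r i j" using j(1) unfolding wo_limit_def by blast
    then have iF: "i \<in> Field r" and ij: "underS r j = under r i" unfolding wo_suc_def by auto
    have "i \<in> underS r j" unfolding ij using iF r.REFL unfolding under_def refl_on_def by blast
    note iC = below(1)[OF this]
    have "E \<subseteq> F i" if E: "E \<in> F ` Field r" "E \<subset> C" for E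
    proof -
      obtain k where k: "k \<in> Field r" "E = F k" using E(1) by blast
      have "(j, k) \<notin> r" using mono[of j k] j(2) k(2) E(2) by blast
      then have "k \<in> underS r j"
        using r.TOTALS k(1) j(1) E(2) k(2) j(2) unfolding underS_def by blast
      then show ?thesis using mono k(2) unfolding ij under_def by blast
    qed
    moreover have "factor R \<X> M (F i) C"
      using fac[OF i] factor_iff_lmod_isomorphic[OF M \<X> sub[OF iF] sub[OF j(1)]] iC j(2) by auto
    ultimately show "\<exists>D\<in>F ` Field r. factor R \<X> M D C \<and> D \<subset> C \<and> (\<forall>E\<in>F ` Field r. E \<subset> C \<longrightarrow> E \<subseteq> D)"
      using iC iF by blast
  qed
qed

text \<open>The members of the tower serve as their own indices, ordered by inclusion. This gives a
  well-order on \<open>'m set\<close>, the index type that \<open>Filt\<close> prescribes.\<close>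

lemma class_filtration_of_tower:
  fixes M :: "('r, 'm) module"
  assumes M: "left_module R M" and \<X>: "\<And>X. X \<in> \<X> \<Longrightarrow> left_module R X"
    and t: "tower (factor R \<X> M) \<C> {\<zero>\<^bsub>M\<^esub>} (carrier M)"
  shows "class_filtration R \<X> M {(A, B). A \<in> \<C> \<and> B \<in> \<C> \<and> A \<subseteq> B} (\<lambda>A. A)"
proof -
  interpret M: left_module R M by fact
  let ?r = "{(A, B). A \<in> \<C> \<and> B \<in> \<C> \<and> A \<subseteq> B}"
  note sub = tower_factor_submodule[OF M t M.submodule_zero]
  have Field: "Field ?r = \<C>" unfolding Field_def by auto
  have under: "under ?r A = {B\<in>\<C>. B \<subseteq> A}" if "A \<in> \<C>" for A
    using that unfolding under_def by auto
  have underS: "underS ?r A = {B\<in>\<C>. B \<subset> A}" if "A \<in> \<C>" for A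
    using that unfolding underS_def by auto
  have "wf (?r - Id)"
    unfolding wf_eq_minimal
  proof (intro allI impI)
    fix Q and A :: "'m set" assume A: "A \<in> Q"
    show "\<exists>Z\<in>Q. \<forall>Y. (Y, Z) \<in> ?r - Id \<longrightarrow> Y \<notin> Q"
    proof (cases "A \<in> \<C>")
      case True
      from tower_least[OF t this, of "\<lambda>C. C \<in> Q"] A obtain D
        where D: "D \<in> \<C>" "D \<in> Q" "\<And>E. E \<in> \<C> \<Longrightarrow> E \<in> Q \<Longrightarrow> D \<subseteq> E" by blast
      then show ?thesis by (intro bexI[of _ D]) auto
    next
      case False
      then show ?thesis using A by blast
    qed
  qed
  then have wo: "Well_order ?r"
    unfolding well_order_on_def linear_order_on_def partial_order_on_def preorder_on_def Field
    using tower_linear[OF t] by (auto simp: refl_on_def trans_def antisym_def total_on_def)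
  have suc: "\<exists>D\<in>\<C>. factor R \<X> M D B \<and> D \<subset> B \<and> wo_suc ?r D B" if B: "B \<in> \<C>" "B \<noteq> {\<zero>\<^bsub>M\<^esub>}" "B \<noteq> \<Union>{D\<in>\<C>. D \<subset> B}" for B
    using B(1)
  proof (cases rule: tower_cases[OF t, consumes 1])
    case (3 D)
    then show ?thesis
      using B(1) unfolding wo_suc_def Field by (intro bexI[of _ D]) (auto simp: under underS)
  qed (use B in simp_all)
  have lim: "B = (\<Union>A\<in>underS ?r B. A)" if B: "wo_limit ?r B" for B
  proof -
    have BC: "B \<in> \<C>" and ne: "underS ?r B \<noteq> {}" and ns: "\<nexists>i. wo_suc ?r i B"
      using B unfolding wo_limit_def Field by auto
    have "B \<noteq> {\<zero>\<^bsub>M\<^esub>}" using ne tower_ge[OF t] unfolding underS[OF BC] by blast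
    then show ?thesis using suc[OF BC] ns underS[OF BC] by auto
  qed
  have fac: "\<exists>X\<in>\<X>. lmod_isomorphic R (lmod_quot (M\<lparr>carrier := B\<rparr>) A) X" if AB: "wo_suc ?r A B" for A B
  proof -
    have J: "A \<in> \<C>" "B \<in> \<C>" using AB unfolding wo_suc_def Field by auto
    then have nxt: "{C\<in>\<C>. C \<subset> B} = {C\<in>\<C>. C \<subseteq> A}"
      using AB under underS unfolding wo_suc_def by simp
    have "A \<subset> B" using nxt J by blast
    then have "B \<noteq> {\<zero>\<^bsub>M\<^esub>}" using tower_ge[OF t J(1)] by blast
    moreover have "B \<noteq> \<Union>{D\<in>\<C>. D \<subset> B}" unfolding nxt using \<open>A \<subset> B\<close> by blast
    ultimately obtain D where D: "D \<in> \<C>" "factor R \<X> M D B" "D \<subset> B" "wo_suc ?r D B"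
      using suc[OF J(2)] by blast
    \<comment> \<open>A successor has only one predecessor, so the \<open>D\<close> supplied by the
      tower is the given \<open>A\<close>.\<close>
    have "{C\<in>\<C>. C \<subseteq> D} = {C\<in>\<C>. C \<subseteq> A}"
      using D(4) nxt under[OF D(1)] underS[OF J(2)] unfolding wo_suc_def by simp
    then have "D = A" using D(1) J(1) by blast
    then show ?thesis
      using D factor_iff_lmod_isomorphic[OF M \<X> sub[OF J(1)] sub[OF J(2)]] by auto
  qed
  show ?thesis
    unfolding class_filtration_def filtration_def
  proof (intro conjI allI impI ballI)
    show "\<exists>A\<in>Field ?r. aboveS ?r A = {} \<and> A = carrier M"
      using tower_top[OF t] tower_le[OF t] unfolding Field aboveS_def by blast
    show "A = {\<zero>\<^bsub>M\<^esub>}" if "A \<in> Field ?r" "underS ?r A = {}" for A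
      using that tower_bot[OF t] tower_ge[OF t] underS[of A] unfolding Field by blast
    show "submodule A R M" if "A \<in> Field ?r" for A using that sub unfolding Field by blast
    show "A \<subseteq> B" if "(A, B) \<in> ?r" for A B using that by blast
  qed (fact wo lim fac)+
qed

lemma Filt_iff_tower:
  assumes "\<And>X. X \<in> \<X> \<Longrightarrow> left_module R X"
  shows "M \<in> Filt R \<X> \<longleftrightarrow>
    left_module R M \<and> (\<exists>\<C>. tower (factor R \<X> M) \<C> {\<zero>\<^bsub>M\<^esub>} (carrier M))"
  using tower_of_class_filtration[OF _ assms] class_filtration_of_tower[OF _ assms]
  unfolding Filt_def by blast

section \<open>Closure properties of \<open>Filt\<close>\<close>

context
  fixes R :: "('r, 's) ring_scheme" and \<X> :: "('r, 'x) module set"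
  assumes \<X>: "semibrick R \<X>"
begin

lemma semibrick_brick: "X \<in> \<X> \<Longrightarrow> brick R X"
  using \<X> unfolding semibrick_def by blast

lemma semibrick_left_module: "X \<in> \<X> \<Longrightarrow> left_module R X"
  using semibrick_brick unfolding brick_def by blast

lemma Filt_left_module: "M \<in> Filt R \<X> \<Longrightarrow> left_module R M"
  unfolding Filt_def by blast

lemma Filt_tower:
  assumes "M \<in> Filt R \<X>"
  obtains \<C> where "tower (factor R \<X> M) \<C> {\<zero>\<^bsub>M\<^esub>} (carrier M)"
  using assms Filt_iff_tower[of \<X> R M, OF semibrick_left_module] by blast

lemma FiltI:
  assumes "left_module R M" "tower (factor R \<X> M) \<C> {\<zero>\<^bsub>M\<^esub>} (carrier M)"
  shows "M \<in> Filt R \<X>"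
  using assms Filt_iff_tower[of \<X> R M, OF semibrick_left_module] by blast

lemma Filt_zero:
  assumes "left_module R Z" "carrier Z = {\<zero>\<^bsub>Z\<^esub>}"
  shows "Z \<in> Filt R \<X>"
  by (rule FiltI[OF assms(1)]) (unfold assms(2), rule tower_singleton)

text \<open>The filtration of \<open>M\<close>, pushed forward along \<open>f\<close>, climbs from
  zero to the kernel of \<open>g\<close>. From there the preimages under \<open>g\<close> of the
  filtration of \<open>N\<close> lead up to \<open>E\<close>.\<close>

lemma Filt_extension:
  fixes M :: "('r, 'm) module" and N :: "('r, 'n) module" and E :: "('r, 'e) module"
  assumes MF: "M \<in> Filt R \<X>" and NF: "N \<in> Filt R \<X>" and E: "left_module R E"
    and f: "f \<in> lmod_hom R M E" and g: "g \<in> lmod_hom R E N"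
    and inj: "inj_on f (carrier M)" and exact: "f ` carrier M = a_kernel E N g"
    and surj: "g ` carrier E = carrier N"
  shows "E \<in> Filt R \<X>"
proof -
  note M = Filt_left_module[OF MF] and N = Filt_left_module[OF NF]
  interpret M: left_module R M by (fact M)
  interpret N: left_module R N by (fact N)
  interpret E: left_module R E by (fact E)
  obtain \<C> where t: "tower (factor R \<X> M) \<C> {\<zero>\<^bsub>M\<^esub>} (carrier M)" using Filt_tower[OF MF] .
  obtain \<D> where t': "tower (factor R \<X> N) \<D> {\<zero>\<^bsub>N\<^esub>} (carrier N)" using Filt_tower[OF NF] .
  note sub = tower_factor_submodule[OF M t M.submodule_zero]
  note sub' = tower_factor_submodule[OF N t' N.submodule_zero]
  have "tower (factor R \<X> E) ((`) f ` \<C>) (f ` {\<zero>\<^bsub>M\<^esub>}) (f ` carrier M)"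
  proof (rule tower_image[OF t])
    fix C D assume CD: "C \<in> \<C>" "D \<in> \<C>" "factor R \<X> M C D" "C \<subset> D"
    note C = sub[OF CD(1)] and D = sub[OF CD(2)]
    note fC = submodule_hom_image[OF M E f C] and fD = submodule_hom_image[OF M E f D]
    have "f x \<in> f ` C \<longleftrightarrow> x \<in> C" if "x \<in> D" for x
      using inj that M.submoduleD(1)[OF C] M.submoduleD(3)[OF D] by (auto dest: inj_onD)
    from factor_push[OF M E semibrick_left_module f CD(3) fC this]
    show "factor R \<X> E (f ` C) (f ` D)"
      using E.set_add_absorb[OF fC fD image_mono] CD(4) by simp
  qed auto
  moreover have "f ` {\<zero>\<^bsub>M\<^esub>} = {\<zero>\<^bsub>E\<^esub>}" using lmod_hom_arith(1)[OF M E f] by simp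
  moreover have "f ` carrier M = {x\<in>carrier E. g x \<in> {\<zero>\<^bsub>N\<^esub>}}" unfolding exact a_kernel_def' by simp
  ultimately have 1: "tower (factor R \<X> E) ((`) f ` \<C>) {\<zero>\<^bsub>E\<^esub>} {x\<in>carrier E. g x \<in> {\<zero>\<^bsub>N\<^esub>}}"
    by simp
  have "tower (factor R \<X> E) ((\<lambda>D. {x\<in>carrier E. g x \<in> D}) ` \<D>)
      {x\<in>carrier E. g x \<in> {\<zero>\<^bsub>N\<^esub>}} {x\<in>carrier E. g x \<in> carrier N}"
  proof (rule tower_image[OF t'])
    fix V W assume VW: "V \<in> \<D>" "W \<in> \<D>" "factor R \<X> N V W" "V \<subset> W"
    show "factor R \<X> E {x\<in>carrier E. g x \<in> V} {x\<in>carrier E. g x \<in> W}"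
    proof (rule factor_pull[OF E N semibrick_left_module g VW(3)])
      fix w assume "w \<in> W"
      then have w: "w \<in> carrier N" using N.submoduleD(3)[OF sub'[OF VW(2)]] by blast
      then obtain x where x: "x \<in> carrier E" "w = g x" using surj by blast
      then have "w = \<zero>\<^bsub>N\<^esub> \<oplus>\<^bsub>N\<^esub> g x" using w by simp
      then show "\<exists>x\<in>carrier E. \<exists>v\<in>V. w = v \<oplus>\<^bsub>N\<^esub> g x"
        using x(1) N.submoduleD(2)[OF sub'[OF VW(1)]] by blast
    qed
  qed auto
  moreover have "{x\<in>carrier E. g x \<in> carrier N} = carrier E" using lmod_homD(1)[OF g] by blast
  ultimately have 2: "tower (factor R \<X> E) ((\<lambda>D. {x\<in>carrier E. g x \<in> D}) ` \<D>)
      {x\<in>carrier E. g x \<in> {\<zero>\<^bsub>N\<^esub>}} (carrier E)" by simp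
  show ?thesis using FiltI[OF E tower_append[OF 1 2]] .
qed

text \<open>A direct sum is a split extension; inclusion and projection are carried over to
  \<open>S\<close> along the isomorphism.\<close>

lemma Filt_sum:
  fixes M :: "('r, 'm) module" and N :: "('r, 'n) module" and S :: "('r, 'e) module"
  assumes MF: "M \<in> Filt R \<X>" and NF: "N \<in> Filt R \<X>" and S: "left_module R S"
    and iso: "lmod_isomorphic R S (lmod_sum M N)"
  shows "S \<in> Filt R \<X>"
proof -
  note M = Filt_left_module[OF MF] and N = Filt_left_module[OF NF]
  interpret M: left_module R M by (fact M)
  interpret N: left_module R N by (fact N)
  obtain s where s: "s \<in> lmod_hom R S (lmod_sum M N)" and bij: "bij_betw s (carrier S) (carrier (lmod_sum M N))"
    using iso unfolding lmod_isomorphic_def by blast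
  let ?t = "inv_into (carrier S) s"
  have t: "?t \<in> lmod_hom R (lmod_sum M N) S" using lmod_hom_inv_into[OF S s bij] .
  have st: "s (?t p) = p" if "p \<in> carrier (lmod_sum M N)" for p
    using that bij by (simp add: bij_betw_inv_into_right)
  have ts: "?t (s x) = x" if "x \<in> carrier S" for x
    using that bij by (simp add: bij_betw_inv_into_left)
  have "(\<lambda>x. (x, \<zero>\<^bsub>N\<^esub>)) \<in> lmod_hom R M (lmod_sum M N)" "snd \<in> lmod_hom R (lmod_sum M N) N"
    by (rule lmod_homI; auto simp: lmod_sum_def)+
  note f = lmod_hom_comp[OF this(1) t] and g = lmod_hom_comp[OF s this(2)]
  have in_sum: "(x, \<zero>\<^bsub>N\<^esub>) \<in> carrier (lmod_sum M N)" if "x \<in> carrier M" for x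
    using that by (simp add: lmod_sum_def)
  show ?thesis
  proof (rule Filt_extension[OF MF NF S f g])
    show "inj_on (\<lambda>x. ?t (x, \<zero>\<^bsub>N\<^esub>)) (carrier M)"
      by (rule inj_onI) (metis st in_sum prod.inject)
    show "(\<lambda>x. ?t (x, \<zero>\<^bsub>N\<^esub>)) ` carrier M = a_kernel S N (\<lambda>x. snd (s x))"
    proof
      show "(\<lambda>x. ?t (x, \<zero>\<^bsub>N\<^esub>)) ` carrier M \<subseteq> a_kernel S N (\<lambda>x. snd (s x))"
        using st[OF in_sum] lmod_homD(1)[OF f] by (auto simp: a_kernel_def')
      show "a_kernel S N (\<lambda>x. snd (s x)) \<subseteq> (\<lambda>x. ?t (x, \<zero>\<^bsub>N\<^esub>)) ` carrier M"
      proof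
        fix x assume "x \<in> a_kernel S N (\<lambda>x. snd (s x))"
        then have x: "x \<in> carrier S" "snd (s x) = \<zero>\<^bsub>N\<^esub>" by (auto simp: a_kernel_def')
        have "s x \<in> carrier (lmod_sum M N)" using lmod_homD(1)[OF s x(1)] .
        then have "fst (s x) \<in> carrier M" by (auto simp: lmod_sum_def)
        moreover have "x = ?t (fst (s x), \<zero>\<^bsub>N\<^esub>)" using ts[OF x(1)] x(2) by (metis prod.collapse)
        ultimately show "x \<in> (\<lambda>x. ?t (x, \<zero>\<^bsub>N\<^esub>)) ` carrier M" by blast
      qed
    qed
    show "(\<lambda>x. snd (s x)) ` carrier S = carrier N"
    proof
      show "(\<lambda>x. snd (s x)) ` carrier S \<subseteq> carrier N" using lmod_homD(1)[OF g] by blast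
      show "carrier N \<subseteq> (\<lambda>x. snd (s x)) ` carrier S"
      proof
        fix y assume "y \<in> carrier N"
        then have p: "(\<zero>\<^bsub>M\<^esub>, y) \<in> carrier (lmod_sum M N)" by (simp add: lmod_sum_def)
        then have "y = snd (s (?t (\<zero>\<^bsub>M\<^esub>, y)))" using st by simp
        then show "y \<in> (\<lambda>x. snd (s x)) ` carrier S" using lmod_homD(1)[OF t p] by blast
      qed
    qed
  qed
qed

lemma Filt_good: "M \<in> Filt R \<X> \<Longrightarrow> good R \<X> M {\<zero>\<^bsub>M\<^esub>}"
  by (rule Filt_tower, assumption)
    (rule tower_good[OF \<X> Filt_left_module _ left_module.submodule_zero[OF Filt_left_module]])

text \<open>Modulo the image of the preceding steps, each step of the filtration of \<open>M\<close> is mapped to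
  zero or injectively, so the kernel takes up the whole step or nothing of it.\<close>

lemma Filt_kernel:
  fixes M :: "('r, 'm) module" and N :: "('r, 'n) module" and K :: "('r, 'k) module"
  assumes MF: "M \<in> Filt R \<X>" and NF: "N \<in> Filt R \<X>" and f: "f \<in> lmod_hom R M N"
    and K: "left_module R K" and iso: "lmod_isomorphic R K (M\<lparr>carrier := a_kernel M N f\<rparr>)"
  shows "K \<in> Filt R \<X>"
proof -
  note M = Filt_left_module[OF MF] and N = Filt_left_module[OF NF]
  interpret M: left_module R M by (fact M)
  interpret N: left_module R N by (fact N)
  interpret K: left_module R K by (fact K)
  let ?A = "a_kernel M N f"
  obtain i where "i \<in> lmod_hom R K (M\<lparr>carrier := ?A\<rparr>)" and bij: "bij_betw i (carrier K) ?A"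
    using iso unfolding lmod_isomorphic_def by auto
  moreover have "?A \<subseteq> carrier M" by (auto simp: a_kernel_def')
  ultimately have i: "i \<in> lmod_hom R K M" using lmod_hom_codomain by blast
  have fi: "f (i x) = \<zero>\<^bsub>N\<^esub>" if "x \<in> carrier K" for x
    using bij that unfolding bij_betw_def a_kernel_def' by blast
  obtain \<C> where t: "tower (factor R \<X> M) \<C> {\<zero>\<^bsub>M\<^esub>} (carrier M)" using Filt_tower[OF MF] .
  note sub = tower_factor_submodule[OF M t M.submodule_zero]
  note fsub = submodule_hom_image[OF M N f]
  have good: "good R \<X> N (f ` C)" if "C \<in> \<C>" for C
  proof -
    have "{\<zero>\<^bsub>N\<^esub>} <+>\<^bsub>N\<^esub> f ` C = f ` C"
      using N.submoduleD(2)[OF fsub[OF sub[OF that]]]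
      by (intro N.set_add_absorb N.submodule_zero fsub sub that) auto
    then show ?thesis
      using good_add_image[OF semibrick_brick M N f Filt_good[OF NF] t that] by simp
  qed
  have "tower (factor R \<X> K) ((\<lambda>C. {x\<in>carrier K. i x \<in> C}) ` \<C>)
      {x\<in>carrier K. i x \<in> {\<zero>\<^bsub>M\<^esub>}} {x\<in>carrier K. i x \<in> carrier M}"
  proof (rule tower_image[OF t])
    fix C D assume CD: "C \<in> \<C>" "D \<in> \<C>" "factor R \<X> M C D" "C \<subset> D"
      and ne: "{x\<in>carrier K. i x \<in> C} \<noteq> {x\<in>carrier K. i x \<in> D}"
    note C = M.submoduleD[OF sub[OF CD(1)]] and D = M.submoduleD[OF sub[OF CD(2)]]
    \<comment> \<open>If \<open>f D\<close> were larger than \<open>f C\<close>, the step would be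
      mapped injectively, so every \<open>x\<close> in \<open>D\<close> with \<open>f x\<close> in
      \<open>f C\<close> would lie in \<open>C\<close>. This includes the kernel elements in
      \<open>D\<close>, against \<open>ne\<close>.\<close>
    have fDC: "f ` D \<subseteq> f ` C"
    proof (rule ccontr)
      assume nz: "\<not> f ` D \<subseteq> f ` C"
      note step = good_step(1)[OF M N semibrick_brick f CD(3) good[OF CD(1)] subset_refl nz]
      have "i x \<in> C" if x: "x \<in> carrier K" "i x \<in> D" for x
      proof -
        have "f (i x) \<in> f ` C" using fi[OF x(1)] N.submoduleD(2)[OF fsub[OF sub[OF CD(1)]]] by simp
        then show ?thesis using step x(2) by blast
      qed
      then show False using ne CD(4) by blast
    qed
    \<comment> \<open>An element of \<open>D\<close> has the same image under \<open>f\<close> as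
      one of \<open>C\<close>, and their difference is in the kernel, which is the image of
      \<open>i\<close>. So \<open>D\<close> lies in the sum of \<open>C\<close> and the kernel, and
      the whole factor is found in \<open>K\<close>.\<close>
    show "factor R \<X> K {x\<in>carrier K. i x \<in> C} {x\<in>carrier K. i x \<in> D}"
    proof (rule factor_pull[OF K M semibrick_left_module i CD(3)])
      fix w assume w: "w \<in> D"
      then obtain v where v: "v \<in> C" "f w = f v" using fDC by blast
      have c: "w \<in> carrier M" "v \<in> carrier M" using w v C(3) D(3) by auto
      have "f (w \<ominus>\<^bsub>M\<^esub> v) = \<zero>\<^bsub>N\<^esub>"
        using lmod_hom_arith(3)[OF M N f c] v(2) lmod_homD(1)[OF f c(2)] by (simp add: N.minus_eq N.r_neg)
      then have "w \<ominus>\<^bsub>M\<^esub> v \<in> ?A" using c by (simp add: a_kernel_def')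
      then obtain x where x: "x \<in> carrier K" "w \<ominus>\<^bsub>M\<^esub> v = i x" using bij unfolding bij_betw_def by blast
      have "w = v \<oplus>\<^bsub>M\<^esub> (w \<ominus>\<^bsub>M\<^esub> v)" using c by (simp add: M.minus_eq M.a_lcomm[of v w] M.r_neg)
      then show "\<exists>x\<in>carrier K. \<exists>v\<in>C. w = v \<oplus>\<^bsub>M\<^esub> i x" using x v(1) by metis
    qed
  qed auto
  moreover have "{x\<in>carrier K. i x \<in> carrier M} = carrier K" using lmod_homD(1)[OF i] by blast
  moreover have "{x\<in>carrier K. i x \<in> {\<zero>\<^bsub>M\<^esub>}} = {\<zero>\<^bsub>K\<^esub>}"
  proof -
    have i0: "i \<zero>\<^bsub>K\<^esub> = \<zero>\<^bsub>M\<^esub>" using lmod_hom_arith(1)[OF K M i] .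
    then have "x = \<zero>\<^bsub>K\<^esub>" if "x \<in> carrier K" "i x = \<zero>\<^bsub>M\<^esub>" for x
      using bij that K.zero_closed unfolding bij_betw_def by (metis inj_onD)
    then show ?thesis using i0 by auto
  qed
  ultimately show ?thesis using FiltI[OF K] by simp
qed

text \<open>The images in \<open>C\<close> of the members of the filtration of \<open>N\<close> form
  the new filtration. A step either collapses or keeps its factor, by goodness of the quotient of
  \<open>N\<close> by the lower member plus the image of \<open>f\<close>.\<close>

lemma Filt_cokernel:
  fixes M :: "('r, 'm) module" and N :: "('r, 'n) module" and C :: "('r, 'c) module"
  assumes MF: "M \<in> Filt R \<X>" and NF: "N \<in> Filt R \<X>" and f: "f \<in> lmod_hom R M N"
    and C: "left_module R C" and iso: "lmod_isomorphic R C (lmod_quot N (f ` carrier M))"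
  shows "C \<in> Filt R \<X>"
proof -
  note M = Filt_left_module[OF MF] and N = Filt_left_module[OF NF]
  interpret M: left_module R M by (fact M)
  interpret N: left_module R N by (fact N)
  interpret C: left_module R C by (fact C)
  let ?I = "f ` carrier M"
  have I: "submodule ?I R N" using submodule_hom_image[OF M N f M.submodule_carrier] .
  obtain s where s: "s \<in> lmod_hom R C (lmod_quot N ?I)" "bij_betw s (carrier C) (carrier (lmod_quot N ?I))"
    using iso unfolding lmod_isomorphic_def by blast
  obtain k where k: "k \<in> lmod_hom R N C" and surj: "k ` carrier N = carrier C"
    and ker: "\<And>x. x \<in> carrier N \<Longrightarrow> k x = \<zero>\<^bsub>C\<^esub> \<longleftrightarrow> x \<in> ?I"
    using epi_of_lmod_quot_iso[OF N I C lmod_hom_inv_into[OF C s] bij_betw_inv_into[OF s(2)]] by blast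
  note kD = lmod_homD[OF k] lmod_hom_arith[OF N C k]
  obtain \<C> where tM: "tower (factor R \<X> M) \<C> {\<zero>\<^bsub>M\<^esub>} (carrier M)" using Filt_tower[OF MF] .
  obtain \<D> where t: "tower (factor R \<X> N) \<D> {\<zero>\<^bsub>N\<^esub>} (carrier N)" using Filt_tower[OF NF] .
  note sub = tower_factor_submodule[OF N t N.submodule_zero]
  have "tower (factor R \<X> C) ((`) k ` \<D>) (k ` {\<zero>\<^bsub>N\<^esub>}) (k ` carrier N)"
  proof (rule tower_image[OF t])
    fix V W assume VW: "V \<in> \<D>" "W \<in> \<D>" "factor R \<X> N V W" "V \<subset> W" and ne: "k ` V \<noteq> k ` W"
    note V = sub[OF VW(1)] and W = sub[OF VW(2)]
    note kV = submodule_hom_image[OF N C k V] and kW = submodule_hom_image[OF N C k W]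
    \<comment> \<open>\<open>?U\<close> is the preimage of \<open>k V\<close> under
      \<open>k\<close>, so the map from \<open>W/V\<close> to \<open>N/?U\<close> tells whether the
      step survives in \<open>C\<close>.\<close>
    let ?U = "V <+>\<^bsub>N\<^esub> ?I"
    have "good R \<X> N V" using tower_good[OF \<X> N tower_above[OF t VW(1)] V] .
    from good_add_image[OF semibrick_brick M N f this tM tower_top[OF tM]]
    have good: "good R \<X> N ?U" .
    \<comment> \<open>If this map were zero, \<open>k V\<close> and \<open>k W\<close> would
      coincide. The map is induced by the identity of \<open>N\<close>, hence the images under
      \<open>\<lambda>x. x\<close>.\<close>
    have nz: "\<not> (\<lambda>x. x) ` W \<subseteq> ?U"
    proof
      assume *: "(\<lambda>x. x) ` W \<subseteq> ?U"
      have "k x \<in> k ` V" if "x \<in> W" for x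
      proof -
        obtain v y where v: "v \<in> V" "y \<in> ?I" "x = v \<oplus>\<^bsub>N\<^esub> y"
          using * \<open>x \<in> W\<close> unfolding set_add_def' by blast
        have c: "v \<in> carrier N" "y \<in> carrier N" using v N.submoduleD(3)[OF V] N.submoduleD(3)[OF I] by auto
        have "k x = k v" using c v(2,3) kD(1,2) ker by simp
        then show ?thesis using v(1) by blast
      qed
      then show False using ne VW(4) by blast
    qed
    have "(\<lambda>x. x) ` V \<subseteq> ?U" using N.set_add_upper(1)[OF V I] by simp
    note step = good_step(1)[OF N N semibrick_brick lmod_hom_id VW(3) good this nz]
    have "k x \<in> k ` V \<longleftrightarrow> x \<in> V" if x: "x \<in> W" for x
    proof
      assume "k x \<in> k ` V"
      then obtain v where v: "v \<in> V" "k x = k v" by blast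
      have c: "x \<in> carrier N" "v \<in> carrier N" using x v N.submoduleD(3)[OF V] N.submoduleD(3)[OF W] by auto
      have "k (x \<ominus>\<^bsub>N\<^esub> v) = \<zero>\<^bsub>C\<^esub>" using kD(6)[OF c] v(2) kD(1)[OF c(2)] by (simp add: C.minus_eq C.r_neg)
      then have "x \<ominus>\<^bsub>N\<^esub> v \<in> ?I" using ker c by simp
      moreover have "x = v \<oplus>\<^bsub>N\<^esub> (x \<ominus>\<^bsub>N\<^esub> v)" using c by (simp add: N.minus_eq N.a_lcomm[of v x] N.r_neg)
      ultimately have "x \<in> ?U" using v(1) unfolding set_add_def' by blast
      then show "x \<in> V" using step x by blast
    qed blast
    from factor_push[OF N C semibrick_left_module k VW(3) kV this]
    show "factor R \<X> C (k ` V) (k ` W)" using C.set_add_absorb[OF kV kW image_mono] VW(4) by simp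
  qed auto
  then show ?thesis using FiltI[OF C] kD(4) surj by simp
qed

end

theorem theorem3p11:
  fixes R :: "('r, 's) ring_scheme" and \<X> :: "('r, 'x) module set"
  assumes "ring R" and "semibrick R \<X>"
  shows "wide_subcategory R (Filt R \<X> :: ('r, 'm) module set)"
proof -
  note \<X> = assms(2)
  show ?thesis
    unfolding wide_subcategory_def abelian_subcategory_def extension_closed_def
    by (intro conjI ballI allI impI; (elim conjE)?)
      (rule Filt_left_module[OF \<X>] Filt_zero[OF \<X>] Filt_sum[OF \<X>] Filt_kernel[OF \<X>]
        Filt_cokernel[OF \<X>] Filt_extension[OF \<X>]; assumption)+
qed

end
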